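(* Let $G$ be a centerless group whose set of elements is a subset of $\omega$. Let $\mathfrak{A}$ be the structure with universe $\omega\cup\mathcal{P}(\omega)$, equipped with the arithmetic operations of $\mathbb{N}$ on $\omega$, the membership relation between elements of $\omega$ and elements of $\mathcal{P}(\omega)$, and the product of $G$. Then $\tau_G<\delta(\mathfrak{A})$, the inductive ordinal of $\mathfrak{A}$.
   Context: For a structure $M$ and a first-order formula $\varphi(x,X)$ in the language of $M$ (possibly with parameters from $M$), where $x$ is a single variable and $X$ is a monadic (unary predicate) variable not quantified in $\varphi$, define $X^\varphi_0=\emptyset$, $X^\varphi_{\alpha+1}=X^\varphi_\alpha\cup\{x\in M: M\models\varphi(x,X^\varphi_\alpha)\}$, and $X^\varphi_\delta=\bigcup_{\beta<\delta}X^\varphi_\beta$ for limit $\delta$. Let $\delta_\varphi=\min\{\alpha:X^\varphi_\alpha=X^\varphi_{\alpha+1}\}$. The inductive ordinal $\delta(M)$ is the least ordinal $\delta$ such that $\delta_\varphi<\delta$ for all such formulas $\varphi$. For a centerless group $G$, the automorphism tower is $G^0=G$, $G^{\alpha+1}=\mathrm{Aut}(G^\alpha)$ (identifying $G^\alpha$ with $\mathrm{Inn}(G^\alpha)$), $G^\delta=\bigcup_{\alpha<\delta}G^\alpha$ for limit $\delta$, and $\tau_G=\min\{\alpha:G^{\alpha+1}=G^\alpha\}$. *)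

theory Defs
  imports "HOL-Algebra.Bij" "HOL-Library.Infinite_Typeclass"
begin

unbundle cardinal_syntax

section \<open>Ordinals\<close>

text \<open>The elements of \<open>'a ordinal\<close> are the order types of the well-orders of subsets of
  \<^typ>\<open>'a\<close>; for infinite \<^typ>\<open>'a\<close> they form an initial segment of the ordinals whose length is
  the successor cardinal of the cardinality of \<^typ>\<open>'a\<close>.\<close>

quotient_type 'a ordinal = "'a rel" / partial: "\<lambda>r s. (r, s) \<in> ordIso"
proof (rule part_equivpI)
  have "Well_order ({} :: 'a rel)" by simp
  then show "\<exists>r :: 'a rel. (r, r) \<in> ordIso" using ordIso_reflexive by blast
  show "symp (\<lambda>r s :: 'a rel. (r, s) \<in> ordIso)" by (simp add: ordIso_symmetric symp_def)
  show "transp (\<lambda>r s :: 'a rel. (r, s) \<in> ordIso)" 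
    by (rule transpI) (rule ordIso_transitive)
qed

instantiation ordinal :: (type) linorder
begin

lift_definition less_eq_ordinal :: "'a ordinal \<Rightarrow> 'a ordinal \<Rightarrow> bool"
  is "\<lambda>r s. (r, s) \<in> ordLeq"
  by (meson ordIso_symmetric ordIso_ordLeq_trans ordLeq_ordIso_trans)

lift_definition less_ordinal :: "'a ordinal \<Rightarrow> 'a ordinal \<Rightarrow> bool"
  is "\<lambda>r s. (r, s) \<in> ordLess"
  by (meson ordIso_symmetric ordIso_ordLess_trans ordLess_ordIso_trans)

lemma ordIso_Well_order: "r =o s \<Longrightarrow> Well_order r \<and> Well_order s"
  by (simp add: ordIso_def)

instance
proof
  fix x y z :: "'a ordinal"
  show "(x < y) = (x \<le> y \<and> \<not> y \<le> x)"
    by transfer (meson ordIso_Well_order not_ordLeq_iff_ordLess ordLess_imp_ordLeq)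
  show "x \<le> x" by transfer (rule ordIso_imp_ordLeq)
  show "x \<le> y \<Longrightarrow> y \<le> z \<Longrightarrow> x \<le> z" by transfer (rule ordLeq_transitive)
  show "x \<le> y \<Longrightarrow> y \<le> x \<Longrightarrow> x = y" by transfer (simp add: ordIso_iff_ordLeq)
  show "x \<le> y \<or> y \<le> x" by transfer (intro ordLeq_total; simp add: ordIso_Well_order)
qed

end

lemma abs_rep_ordinal: "abs_ordinal (rep_ordinal x) = x"
  by (rule Quotient3_abs_rep[OF Quotient3_ordinal])

lemma rep_ordinal_refl: "rep_ordinal x =o rep_ordinal x"
  by (rule Quotient3_rep_reflp[OF Quotient3_ordinal])

lemma rep_ordinal_less: "x < y \<Longrightarrow> rep_ordinal x <o rep_ordinal y"
  using less_ordinal.abs_eq[OF rep_ordinal_refl rep_ordinal_refl, of x y]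
  by (simp add: abs_rep_ordinal)

instance ordinal :: (type) wellorder
proof
  fix P :: "'a ordinal \<Rightarrow> bool" and a :: "'a ordinal"
  assume step: "\<And>x. (\<And>y. y < x \<Longrightarrow> P y) \<Longrightarrow> P x"
  have "wf (inv_image ordLess (rep_ordinal :: 'a ordinal \<Rightarrow> 'a rel))"
    by (rule wf_inv_image[OF wf_ordLess])
  then show "P a"
  proof (induction a rule: wf_induct_rule)
    case (less x)
    show ?case by (rule step, rule less) (simp add: rep_ordinal_less)
  qed
qed

instance set :: (infinite) infinite
  by intro_classes (simp only: Finite_Set.finite_set infinite_UNIV not_False_eq_True)

instance sum :: (infinite, type) infinite
  proof
  show "infinite (UNIV :: ('a + 'b) set)"
    using infinite_UNIV[where 'a = 'a] by simp
qed

lemma ex_ordLess: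
  fixes r :: "'a :: infinite rel"
  assumes "Well_order r"
  shows "\<exists>s :: 'a rel. r <o s"
proof -
  define a :: 'a where "a = undefined"
  have "\<exists>f. bij_betw f (UNIV :: 'a set) (UNIV - {a})"
    by (rule infinite_imp_bij_betw[OF infinite_UNIV])
  then obtain f where f: "bij_betw f (UNIV :: 'a set) (UNIV - {a})" ..
  define r1 where "r1 = dir_image r f"
  have inj: "inj_on f (Field r)" using f by (meson bij_betw_def inj_on_subset subset_UNIV)
  have iso: "r =o r1" unfolding r1_def using assms inj by (rule dir_image_ordIso)
  have W1: "Well_order r1" using iso ordIso_Well_order by blast
  have a: "a \<notin> Field r1" using f unfolding r1_def dir_image_def Field_def bij_betw_def by auto
  define s where "s = r1 \<union> (insert a (Field r1)) \<times> {a}"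
  have F: "Field s = insert a (Field r1)" unfolding s_def Field_def by auto
  have ax: "\<And>x y. (x, y) \<in> r1 \<Longrightarrow> x \<in> Field r1 \<and> y \<in> Field r1 \<and> x \<noteq> a \<and> y \<noteq> a"
    using a by (auto simp: Field_def)
  have Ws: "Well_order s"
    unfolding well_order_on_def linear_order_on_def partial_order_on_def preorder_on_def
  proof (intro conjI)
    note w = W1[unfolded well_order_on_def linear_order_on_def partial_order_on_def preorder_on_def]
    show "s \<subseteq> Field s \<times> Field s" by (auto simp: Field_def)
    show "Refl s" using w unfolding F refl_on_def by (auto simp: s_def)
    show "trans s" using w ax unfolding trans_def s_def by blast
    show "antisym s" using w ax unfolding antisym_def s_def by blast
    show "Total s" using w unfolding F total_on_def by (auto simp: s_def)
    have "wf (r1 - Id)" using w by blast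
    moreover have "s - Id = (r1 - Id) \<union> (Field r1 \<times> {a})" using a ax unfolding s_def by auto
    moreover have "wf (Field r1 \<times> {a})"
      using a by (intro wf_subset[OF wf_measure[of "\<lambda>x. if x = a then 1 else 0"]]) auto
    moreover have "Domain (r1 - Id) \<inter> Range (Field r1 \<times> {a}) = {}" using ax by auto
    ultimately show "wf (s - Id)" by (simp only: wf_Un)
  qed
  have "underS s a = Field r1" using a ax unfolding underS_def s_def by auto
  then have "Restr s (underS s a) = r1" using ax unfolding s_def Field_def by auto
  moreover have "Restr s (underS s a) <o s" using Ws F by (intro underS_Restr_ordLess) auto
  ultimately show ?thesis using iso ordIso_ordLess_trans by metis
qed

instance ordinal :: (infinite) no_top
proof
  fix x :: "'a ordinal"
  show "\<exists>y. x < y"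
  proof transfer
    fix r :: "'a rel" assume "r =o r"
    then obtain s :: "'a rel" where "r <o s" using ex_ordLess ordIso_Well_order by blast
    moreover then have "s =o s" by (simp add: ordLess_def ordIso_reflexive)
    ultimately show "\<exists>s\<in>{s :: 'a rel. s =o s}. r <o s" by blast
  qed
qed

unbundle no cardinal_syntax

definition ozero :: "'o :: wellorder" where
  "ozero = (LEAST \<alpha>. True)"

definition osuc :: "'o :: wellorder \<Rightarrow> 'o" where
  "osuc \<alpha> = (LEAST \<beta>. \<alpha> < \<beta>)"

definition is_limit :: "'o :: wellorder \<Rightarrow> bool" where
  "is_limit \<delta> \<longleftrightarrow> (\<exists>\<beta>. \<beta> < \<delta>) \<and> (\<forall>\<beta><\<delta>. \<exists>\<gamma><\<delta>. \<beta> < \<gamma>)"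

lemma ozero_le: "ozero \<le> (\<alpha> :: 'o :: wellorder)"
  by (simp add: ozero_def Least_le)

lemma less_osuc: "\<alpha> < osuc (\<alpha> :: 'o :: {wellorder, no_top})"
  unfolding osuc_def using gt_ex by (rule LeastI_ex)

lemma less_osuc_iff: "\<beta> < osuc \<alpha> \<longleftrightarrow> \<beta> \<le> (\<alpha> :: 'o :: {wellorder, no_top})"
  using less_osuc[of \<alpha>] not_less_Least[of \<beta> "\<lambda>\<beta>. \<alpha> < \<beta>"] unfolding osuc_def
  by (meson leI le_less_trans)

lemma osuc_inject: "osuc \<alpha> = osuc \<beta> \<longleftrightarrow> \<alpha> = (\<beta> :: 'o :: {wellorder, no_top})"
  by (metis less_osuc less_osuc_iff order_antisym)

lemma not_limit_osuc: "\<not> is_limit (osuc (\<alpha> :: 'o :: {wellorder, no_top}))"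
  unfolding is_limit_def using less_osuc[of \<alpha>] by (meson less_osuc_iff not_le)

lemma not_limit_ozero: "\<not> is_limit (ozero :: 'o :: wellorder)"
  unfolding is_limit_def using ozero_le by (meson not_le)

lemma osuc_neq_ozero: "osuc (\<alpha> :: 'o :: {wellorder, no_top}) \<noteq> ozero"
  using less_osuc[of \<alpha>] ozero_le[of \<alpha>] by auto

lemma ordinal_cases:
  fixes \<alpha> :: "'o :: {wellorder, no_top}"
  obtains (zero) "\<alpha> = ozero" | (suc) \<beta> where "\<alpha> = osuc \<beta>" | (limit) "is_limit \<alpha>"
proof -
  have "\<alpha> = ozero \<or> (\<exists>\<beta>. \<alpha> = osuc \<beta>)" if "\<not> is_limit \<alpha>"
  proof (rule disjCI)
    assume n: "\<nexists>\<beta>. \<alpha> = osuc \<beta>"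
    have "\<exists>\<gamma><\<alpha>. \<beta> < \<gamma>" if "\<beta> < \<alpha>" for \<beta>
    proof (rule exI[of _ "osuc \<beta>"])
      have "osuc \<beta> \<le> \<alpha>" unfolding osuc_def using that by (rule Least_le)
      then show "osuc \<beta> < \<alpha> \<and> \<beta> < osuc \<beta>" using n less_osuc[of \<beta>] by fastforce
    qed
    then have "\<not> (\<exists>\<beta>. \<beta> < \<alpha>)" using that unfolding is_limit_def by blast
    then show "\<alpha> = ozero" using ozero_le[of \<alpha>] by (metis le_less)
  qed
  then show ?thesis using that by blast
qed


section \<open>First-order formulas with a monadic predicate variable\<close>

text \<open>A structure with universe \<^typ>\<open>'m\<close> interprets every relation symbol in \<^typ>\<open>'s\<close> on lists
  of elements; operations are represented by their graphs.\<close>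

type_synonym ('s, 'm) struc = "'s \<Rightarrow> 'm list \<Rightarrow> bool"

datatype 's fm =
    Equal nat nat
  | Rel 's "nat list"
  | InX nat
  | Neg "'s fm"
  | Conj "'s fm" "'s fm"
  | Ex nat "'s fm"

primrec sat :: "('s, 'm) struc \<Rightarrow> 'm set \<Rightarrow> (nat \<Rightarrow> 'm) \<Rightarrow> 's fm \<Rightarrow> bool" where
  "sat M X e (Equal i j) \<longleftrightarrow> e i = e j"
| "sat M X e (Rel s js) \<longleftrightarrow> M s (map e js)"
| "sat M X e (InX i) \<longleftrightarrow> e i \<in> X"
| "sat M X e (Neg \<phi>) \<longleftrightarrow> \<not> sat M X e \<phi>"
| "sat M X e (Conj \<phi> \<psi>) \<longleftrightarrow> sat M X e \<phi> \<and> sat M X e \<psi>"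
| "sat M X e (Ex i \<phi>) \<longleftrightarrow> (\<exists>a. sat M X (e(i := a)) \<phi>)"


section \<open>The inductive ordinal of a structure\<close>

text \<open>The formula with parameters is given by \<open>\<phi>\<close> and \<open>p\<close>: variable \<open>0\<close> is the variable \<open>x\<close>, and
  each other free variable \<open>i\<close> stands for the parameter \<open>p i\<close>.\<close>

definition formula_set :: "('s, 'm) struc \<Rightarrow> 's fm \<Rightarrow> (nat \<Rightarrow> 'm) \<Rightarrow> 'm set \<Rightarrow> 'm set" where
  "formula_set M \<phi> p X = {x. sat M X (p(0 := x)) \<phi>}"

text \<open>At \<^term>\<open>ozero\<close> the second union is empty, at \<^term>\<open>osuc \<beta>\<close> its only index is \<open>\<beta>\<close>.\<close>

function stage ::
  "('s, 'm) struc \<Rightarrow> 's fm \<Rightarrow> (nat \<Rightarrow> 'm) \<Rightarrow> 'o :: {wellorder, no_top} \<Rightarrow> 'm set" where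
  "stage M \<phi> p \<alpha> =
    (if is_limit \<alpha> then \<Union>\<beta>\<in>{..<\<alpha>}. stage M \<phi> p \<beta>
     else \<Union>\<beta>\<in>{\<beta>. \<alpha> = osuc \<beta>}. stage M \<phi> p \<beta> \<union> formula_set M \<phi> p (stage M \<phi> p \<beta>))"
  by pat_completeness auto
termination
  by (relation "inv_image {(\<alpha>, \<beta>). \<alpha> < \<beta>} (\<lambda>(M, \<phi>, p, \<alpha>). \<alpha>)") (auto simp: wf less_osuc intro!: wf_inv_image)

declare stage.simps[simp del]

lemma stage_ozero: "stage M \<phi> p ozero = {}"
  by (subst stage.simps) (simp add: not_limit_ozero osuc_neq_ozero[symmetric])

lemma stage_osuc:
  "stage M \<phi> p (osuc \<alpha>) = stage M \<phi> p \<alpha> \<union> {x. sat M (stage M \<phi> p \<alpha>) (p(0 := x)) \<phi>}"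
  by (subst stage.simps) (simp add: not_limit_osuc osuc_inject formula_set_def)

lemma stage_limit: "is_limit \<delta> \<Longrightarrow> stage M \<phi> p \<delta> = (\<Union>\<beta>\<in>{..<\<delta>}. stage M \<phi> p \<beta>)"
  by (subst stage.simps) simp

definition closure_ordinal ::
  "('s, 'm) struc \<Rightarrow> 's fm \<Rightarrow> (nat \<Rightarrow> 'm) \<Rightarrow> 'o :: {wellorder, no_top}" where
  "closure_ordinal M \<phi> p = (LEAST \<alpha>. stage M \<phi> p \<alpha> = stage M \<phi> p (osuc \<alpha>))"

text \<open>Over an infinite universe \<^typ>\<open>'m\<close>, the closure ordinals are smaller than the successor
  cardinal of the cardinality of \<^typ>\<open>'m\<close>, which is itself an element of
  \<^typ>\<open>'m set ordinal\<close>.\<close>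

definition inductive_ordinal :: "('s, 'm :: infinite) struc \<Rightarrow> 'm set ordinal" where
  "inductive_ordinal M = (LEAST \<delta>. \<forall>\<phi> p. closure_ordinal M \<phi> p < \<delta>)"


section \<open>Automorphism towers\<close>

definition centerless :: "('a, 'b) monoid_scheme \<Rightarrow> bool" where
  "centerless G \<longleftrightarrow>
    (\<forall>z\<in>carrier G. (\<forall>g\<in>carrier G. z \<otimes>\<^bsub>G\<^esub> g = g \<otimes>\<^bsub>G\<^esub> z) \<longrightarrow> z = \<one>\<^bsub>G\<^esub>)"

definition inner_aut :: "('a, 'b) monoid_scheme \<Rightarrow> 'a \<Rightarrow> 'a \<Rightarrow> 'a" where
  "inner_aut G g = (\<lambda>x\<in>carrier G. g \<otimes>\<^bsub>G\<^esub> x \<otimes>\<^bsub>G\<^esub> inv\<^bsub>G\<^esub> g)"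

definition extends :: "('a, 'b) monoid_scheme \<Rightarrow> ('a, 'c) monoid_scheme \<Rightarrow> bool" where
  "extends H K \<longleftrightarrow> carrier H \<subseteq> carrier K \<and>
    (\<forall>x\<in>carrier H. \<forall>y\<in>carrier H. x \<otimes>\<^bsub>H\<^esub> y = x \<otimes>\<^bsub>K\<^esub> y)"

text \<open>The isomorphism \<open>f\<close> from \<open>T (osuc \<alpha>)\<close> to the automorphism group of \<open>T \<alpha>\<close> is the one that
  identifies \<open>T \<alpha>\<close> with its inner automorphisms. The ordinals indexing the tower are an arbitrary
  limit segment \<open>'o\<close>.\<close>

definition is_automorphism_tower ::
  "('a, 'b) monoid_scheme \<Rightarrow> ('o :: {wellorder, no_top} \<Rightarrow> 'u monoid) \<Rightarrow> bool" where
  "is_automorphism_tower G T \<longleftrightarrow>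
    (\<forall>\<alpha>. group (T \<alpha>)) \<and>
    G \<cong> T ozero \<and>
    (\<forall>\<alpha>. extends (T \<alpha>) (T (osuc \<alpha>)) \<and>
      (\<exists>f\<in>iso (T (osuc \<alpha>)) (AutoGroup (T \<alpha>)). \<forall>g\<in>carrier (T \<alpha>). f g = inner_aut (T \<alpha>) g)) \<and>
    (\<forall>\<delta>. is_limit \<delta> \<longrightarrow>
      carrier (T \<delta>) = (\<Union>\<beta>\<in>{..<\<delta>}. carrier (T \<beta>)) \<and> (\<forall>\<beta><\<delta>. extends (T \<beta>) (T \<delta>)))"

text \<open>This type has room for the whole tower over a group with elements in \<^typ>\<open>'a\<close>: an element of
  the tower outside \<open>G\<close> is determined by the function that maps each element of \<open>G\<close> to its conjugate.\<close>

datatype 'a tower_elt = Base 'a | New "'a \<Rightarrow> 'a tower_elt"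

text \<open>Any two towers of \<open>G\<close> are isomorphic over \<open>G\<close>, so it does not matter which one is chosen;
  existence is theorem \<open>is_automorphism_tower\<close> below.\<close>

definition automorphism_tower ::
  "('a, 'b) monoid_scheme \<Rightarrow> 'o :: {wellorder, no_top} \<Rightarrow> 'a tower_elt monoid" where
  "automorphism_tower G = (SOME T. is_automorphism_tower G T)"

text \<open>The height is meaningful only if \<open>'o\<close> is long enough for the tower to become stationary;
  for a countable group any \<open>'o\<close> of length at least the successor of the continuum will do.
  Carriers are compared because the multiplication of a record is arbitrary outside its carrier.\<close>

definition tower_height :: "('a, 'b) monoid_scheme \<Rightarrow> 'o :: {wellorder, no_top}" where
  "tower_height G =
    (LEAST \<alpha>. carrier (automorphism_tower G (osuc \<alpha>)) = carrier (automorphism_tower G \<alpha>))"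


section \<open>The structure on natural numbers and sets of natural numbers\<close>

text \<open>The universe is the disjoint union of \<open>\<omega>\<close> and its power set; the partial operations on \<open>\<omega>\<close>
  are given by their graphs.\<close>

datatype symbol = Plus | Times | Member | Product

primrec arith_struc :: "nat monoid \<Rightarrow> (symbol, nat + nat set) struc" where
  "arith_struc G Plus xs \<longleftrightarrow> (\<exists>a b. xs = [Inl a, Inl b, Inl (a + b)])"
| "arith_struc G Times xs \<longleftrightarrow> (\<exists>a b. xs = [Inl a, Inl b, Inl (a * b)])"
| "arith_struc G Member xs \<longleftrightarrow> (\<exists>a A. xs = [Inl a, Inr A] \<and> a \<in> A)"
| "arith_struc G Product xs \<longleftrightarrow>
    (\<exists>a\<in>carrier G. \<exists>b\<in>carrier G. xs = [Inl a, Inl b, Inl (a \<otimes>\<^bsub>G\<^esub> b)])"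

section \<open>Existence of automorphism towers\<close>

lemma extends_mult: "extends H K \<Longrightarrow> x \<in> carrier H \<Longrightarrow> y \<in> carrier H \<Longrightarrow> x \<otimes>\<^bsub>K\<^esub> y = x \<otimes>\<^bsub>H\<^esub> y"
  by (simp add: extends_def)

lemma extends_carrier: "extends H K \<Longrightarrow> x \<in> carrier H \<Longrightarrow> x \<in> carrier K"
  by (auto simp: extends_def)

lemma extends_refl: "extends H H" by (simp add: extends_def)

lemma extends_trans: "extends H K \<Longrightarrow> extends K L \<Longrightarrow> extends H L"
  by (auto simp: extends_def subset_iff)

lemma extends_one:
  assumes "extends H K" "group H" "group K"
  shows "\<one>\<^bsub>K\<^esub> = \<one>\<^bsub>H\<^esub>"
proof -
  interpret H: group H by fact
  interpret K: group K by fact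
  have "\<one>\<^bsub>H\<^esub> \<otimes>\<^bsub>K\<^esub> \<one>\<^bsub>H\<^esub> = \<one>\<^bsub>H\<^esub>" using extends_mult[OF assms(1)] by simp
  then show ?thesis using extends_carrier[OF assms(1) H.one_closed]
    by (metis K.l_cancel_one')
qed

lemma extends_inv:
  assumes "extends H K" "group H" "group K" "x \<in> carrier H"
  shows "inv\<^bsub>K\<^esub> x = inv\<^bsub>H\<^esub> x"
proof -
  interpret H: group H by fact
  interpret K: group K by fact
  have "inv\<^bsub>H\<^esub> x \<otimes>\<^bsub>K\<^esub> x = \<one>\<^bsub>K\<^esub>"
    using extends_mult[OF assms(1)] extends_one[OF assms(1-3)] assms(4) by simp
  then show ?thesis using extends_carrier[OF assms(1)] assms(4)
    by (intro K.inv_equality) auto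
qed

lemma auto_carrier [simp]: "carrier (AutoGroup H) = auto H"
  by (simp add: AutoGroup_def)

lemma AutoGroup_mult: "\<sigma> \<in> auto H \<Longrightarrow> \<tau> \<in> auto H \<Longrightarrow>
    \<sigma> \<otimes>\<^bsub>AutoGroup H\<^esub> \<tau> = (\<lambda>x\<in>carrier H. \<sigma> (\<tau> x))"
  by (simp add: AutoGroup_def BijGroup_def auto_def compose_def)

lemma AutoGroup_one: "\<one>\<^bsub>AutoGroup H\<^esub> = (\<lambda>x\<in>carrier H. x)"
  by (simp add: AutoGroup_def BijGroup_def)

lemma auto_closed: "\<sigma> \<in> auto H \<Longrightarrow> x \<in> carrier H \<Longrightarrow> \<sigma> x \<in> carrier H"
  by (auto simp: auto_def hom_def)

lemma auto_mult: "\<sigma> \<in> auto H \<Longrightarrow> x \<in> carrier H \<Longrightarrow> y \<in> carrier H \<Longrightarrow>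
    \<sigma> (x \<otimes>\<^bsub>H\<^esub> y) = \<sigma> x \<otimes>\<^bsub>H\<^esub> \<sigma> y"
  by (auto simp: auto_def hom_def)

lemma auto_eqI: "\<sigma> \<in> auto H \<Longrightarrow> \<tau> \<in> auto H \<Longrightarrow> (\<And>x. x \<in> carrier H \<Longrightarrow> \<sigma> x = \<tau> x) \<Longrightarrow> \<sigma> = \<tau>"
  by (auto simp: auto_def Bij_def intro: extensionalityI)

lemma (in group) inv_mult_one_eq:
  assumes "x \<in> carrier G" "y \<in> carrier G" "inv x \<otimes> y = \<one>"
  shows "y = x"
proof -
  have "inv y = inv x" using inv_equality[of "inv x" y] assms by simp
  then have "inv (inv y) = inv (inv x)" by simp
  then show ?thesis using assms by simp
qed

lemma (in group) conj_cancel: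
  assumes "g \<in> carrier G" "y \<in> carrier G"
  shows "g \<otimes> (inv g \<otimes> y) = y" "inv g \<otimes> (g \<otimes> y) = y"
  using assms by (simp_all flip: m_assoc)

lemma (in group) inner_auto:
  assumes g: "g \<in> carrier G" shows "inner_aut G g \<in> auto G"
proof -
  have c: "g \<otimes> (inv g \<otimes> y) = y" "inv g \<otimes> (g \<otimes> y) = y" if "y \<in> carrier G" for y
    using g that by (simp_all flip: m_assoc)
  have "bij_betw (inner_aut G g) (carrier G) (carrier G)"
    by (rule bij_betwI[where g = "inner_aut G (inv g)"])
       (use g in \<open>auto simp: inner_aut_def m_assoc c\<close>)
  moreover have "inner_aut G g \<in> hom G G"
    using g by (auto simp: inner_aut_def hom_def m_assoc c)
  ultimately show ?thesis by (simp add: auto_def Bij_def inner_aut_def)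
qed

lemma (in group) inner_mult:
  assumes "g \<in> carrier G" "h \<in> carrier G"
  shows "inner_aut G (g \<otimes> h) = inner_aut G g \<otimes>\<^bsub>AutoGroup G\<^esub> inner_aut G h"
  unfolding AutoGroup_mult[OF inner_auto[OF assms(1)] inner_auto[OF assms(2)]]
  using assms by (auto simp: inner_aut_def m_assoc inv_mult_group)

lemma (in group) auto_inner:
  assumes s: "\<sigma> \<in> auto G" and g: "g \<in> carrier G"
  shows "\<sigma> \<otimes>\<^bsub>AutoGroup G\<^esub> inner_aut G g = inner_aut G (\<sigma> g) \<otimes>\<^bsub>AutoGroup G\<^esub> \<sigma>"
proof -
  have i: "\<sigma> (inv g) = inv (\<sigma> g)"
  proof -
    have "\<sigma> (inv g) \<otimes> \<sigma> g = \<sigma> \<one>" using g by (simp flip: auto_mult[OF s])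
    also have "\<sigma> \<one> = \<one>"
      using auto_mult[OF s one_closed one_closed] auto_closed[OF s one_closed] by (simp add: l_cancel_one')
    finally show ?thesis using g auto_closed[OF s] by (metis inv_closed inv_equality)
  qed
  show ?thesis
    unfolding AutoGroup_mult[OF s inner_auto[OF g]]
      AutoGroup_mult[OF inner_auto[OF auto_closed[OF s g]] s]
    using g by (auto simp: auto_closed[OF s] inner_aut_def auto_mult[OF s] i)
qed

lemma (in group) inner_inj:
  assumes "centerless G" "g \<in> carrier G" "h \<in> carrier G" "inner_aut G g = inner_aut G h"
  shows "g = h"
proof -
  have eq: "g \<otimes> x \<otimes> inv g = h \<otimes> x \<otimes> inv h" if "x \<in> carrier G" for x
    using fun_cong[OF assms(4), of x] that by (simp add: inner_aut_def)
  have "(inv h \<otimes> g) \<otimes> x = x \<otimes> (inv h \<otimes> g)" if "x \<in> carrier G" for x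
  proof -
    have "(inv h \<otimes> g) \<otimes> x = inv h \<otimes> (g \<otimes> x \<otimes> inv g) \<otimes> g"
      using that assms(2,3) by (simp add: m_assoc)
    also have "\<dots> = inv h \<otimes> (h \<otimes> x \<otimes> inv h) \<otimes> g"
      using eq[OF that] by simp
    also have "\<dots> = x \<otimes> (inv h \<otimes> g)"
      using that assms(2,3) by (simp add: m_assoc conj_cancel)
    finally show ?thesis .
  qed
  then have "inv h \<otimes> g = \<one>" using assms(1-3) unfolding centerless_def by blast
  then show ?thesis by (rule inv_mult_one_eq[OF assms(3,2)])
qed

definition base_copy :: "('a, 'b) monoid_scheme \<Rightarrow> 'a tower_elt monoid" where
  "base_copy G = \<lparr>carrier = Base ` carrier G,
    mult = \<lambda>x y. Base (inv_into UNIV Base x \<otimes>\<^bsub>G\<^esub> inv_into UNIV Base y), one = Base \<one>\<^bsub>G\<^esub>\<rparr>"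

lemma inj_Base: "inv_into UNIV Base (Base a) = a"
  by (rule inv_f_f) (simp add: inj_on_def)

lemma base_iso: "Base \<in> iso G (base_copy G)"
  by (auto simp: iso_def hom_def base_copy_def inj_Base bij_betw_def inj_on_def)

definition centralizes :: "('a, 'c) monoid_scheme \<Rightarrow> 'a set \<Rightarrow> 'a \<Rightarrow> bool" where
  "centralizes L B h \<longleftrightarrow> (\<forall>b\<in>B. h \<otimes>\<^bsub>L\<^esub> b = b \<otimes>\<^bsub>L\<^esub> h)"

definition triv_cent :: "('a, 'c) monoid_scheme \<Rightarrow> 'a set \<Rightarrow> bool" where
  "triv_cent L B \<longleftrightarrow> (\<forall>h\<in>carrier L. centralizes L B h \<longrightarrow> h = \<one>\<^bsub>L\<^esub>)"

definition rigid :: "'a set \<Rightarrow> 'a monoid \<Rightarrow> bool" where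
  "rigid B H \<longleftrightarrow> (\<forall>L :: 'a monoid. \<forall>\<sigma>. group L \<longrightarrow> extends H L \<longrightarrow> triv_cent L B \<longrightarrow> \<sigma> \<in> hom L L \<longrightarrow>
      (\<forall>b\<in>B. \<sigma> b = b) \<longrightarrow> (\<forall>h\<in>carrier H. \<sigma> h = h))"

definition tower_stage :: "('a, 'b) monoid_scheme \<Rightarrow> 'a tower_elt monoid \<Rightarrow> bool" where
  "tower_stage G H \<longleftrightarrow> group H \<and> extends (base_copy G) H \<and> triv_cent H (Base ` carrier G) \<and>
    rigid (Base ` carrier G) H \<and>
    (\<forall>a. Base a \<in> carrier H \<longrightarrow> a \<in> carrier G) \<and>
    (\<forall>f. New f \<in> carrier H \<longrightarrow> f = (\<lambda>a\<in>carrier G. inner_aut H (New f) (Base a)))"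

definition tower_label :: "('a, 'b) monoid_scheme \<Rightarrow> 'a tower_elt monoid \<Rightarrow> ('a tower_elt \<Rightarrow> 'a tower_elt) \<Rightarrow> 'a tower_elt" where
  "tower_label G H \<sigma> = (if \<exists>g\<in>carrier H. \<sigma> = inner_aut H g then SOME g. g \<in> carrier H \<and> \<sigma> = inner_aut H g
     else New (\<lambda>a\<in>carrier G. \<sigma> (Base a)))"

definition next_group :: "('a, 'b) monoid_scheme \<Rightarrow> 'a tower_elt monoid \<Rightarrow> 'a tower_elt monoid" where
  "next_group G H = (let un = inv_into (auto H) (tower_label G H) in
     \<lparr>carrier = tower_label G H ` auto H,
      mult = \<lambda>x y. tower_label G H (un x \<otimes>\<^bsub>AutoGroup H\<^esub> un y),
      one = tower_label G H \<one>\<^bsub>AutoGroup H\<^esub>\<rparr>)"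

lemma centerless_tower_stage: assumes "tower_stage G H" shows "centerless H"
  unfolding centerless_def
proof (intro ballI impI)
  fix z assume z: "z \<in> carrier H" "\<forall>g\<in>carrier H. z \<otimes>\<^bsub>H\<^esub> g = g \<otimes>\<^bsub>H\<^esub> z"
  have "Base ` carrier G \<subseteq> carrier H" using assms by (simp add: tower_stage_def extends_def base_copy_def)
  then have "centralizes H (Base ` carrier G) z" using z by (auto simp: centralizes_def)
  then show "z = \<one>\<^bsub>H\<^esub>" using assms z by (simp add: tower_stage_def triv_cent_def)
qed

lemma base_copy_group: assumes "group G" shows "group (base_copy G)"
proof -
  interpret G: group G by fact
  show ?thesis using G.iso_imp_img_group[OF base_iso] by (simp add: base_copy_def)
qed

lemma tower_stage_base:
  assumes "group G" "centerless G" shows "tower_stage G (base_copy G)"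
proof -
  have "group (base_copy G)" using assms(1) by (rule base_copy_group)
  moreover have "triv_cent (base_copy G) (Base ` carrier G)"
    using assms(2) by (auto simp: triv_cent_def centralizes_def base_copy_def inj_Base centerless_def)
  moreover have "rigid (Base ` carrier G) (base_copy G)"
    by (auto simp: rigid_def base_copy_def)
  ultimately show ?thesis by (auto simp: tower_stage_def extends_refl) (auto simp: base_copy_def)
qed

locale tower_stage_loc =
  fixes G :: "('a, 'b) monoid_scheme" (structure) and H :: "'a tower_elt monoid"
  assumes good: "tower_stage G H"
begin

sublocale H: group H using good by (simp add: tower_stage_def)

abbreviation "B \<equiv> Base ` carrier G"
abbreviation "K \<equiv> next_group G H"
abbreviation "A \<equiv> AutoGroup H"
abbreviation "un \<equiv> inv_into (auto H) (tower_label G H)"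

sublocale A: group A by (rule H.AutoGroup)

lemma B_sub: "b \<in> B \<Longrightarrow> b \<in> carrier H"
  using good by (auto simp: tower_stage_def extends_def base_copy_def)

lemma auto_fix: "\<sigma> \<in> auto H \<Longrightarrow> (\<And>b. b \<in> B \<Longrightarrow> \<sigma> b = b) \<Longrightarrow> x \<in> carrier H \<Longrightarrow> \<sigma> x = x"
  using good H.group_axioms extends_refl[of H] unfolding tower_stage_def rigid_def auto_def by blast

lemma auto_eq_on_B:
  assumes s: "\<sigma> \<in> auto H" and t: "\<tau> \<in> auto H" and eq: "\<And>b. b \<in> B \<Longrightarrow> \<sigma> b = \<tau> b"
  shows "\<sigma> = \<tau>"
proof -
  define \<tau>' where "\<tau>' = inv\<^bsub>A\<^esub> \<tau>"
  have t': "\<tau>' \<in> auto H" using t A.inv_closed[of \<tau>] by (simp add: \<tau>'_def)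
  have l: "\<tau>' (\<tau> x) = x" if "x \<in> carrier H" for x
  proof -
    have "\<tau>' \<otimes>\<^bsub>A\<^esub> \<tau> = \<one>\<^bsub>A\<^esub>" using t by (simp add: \<tau>'_def)
    from fun_cong[OF this, of x] show ?thesis
      using that by (simp add: AutoGroup_mult[OF t' t] AutoGroup_one)
  qed
  have "\<tau>' \<otimes>\<^bsub>A\<^esub> \<sigma> = \<one>\<^bsub>A\<^esub>"
  proof (rule auto_eqI)
    show i: "\<tau>' \<otimes>\<^bsub>A\<^esub> \<sigma> \<in> auto H" using A.m_closed[of \<tau>' \<sigma>] s t' by simp
    show "\<one>\<^bsub>A\<^esub> \<in> auto H" using A.one_closed by simp
    fix x assume x: "x \<in> carrier H"
    have "(\<tau>' \<otimes>\<^bsub>A\<^esub> \<sigma>) x = x"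
    proof (rule auto_fix[OF i _ x])
      fix b assume "b \<in> B"
      then show "(\<tau>' \<otimes>\<^bsub>A\<^esub> \<sigma>) b = b" using B_sub eq l s t' by (simp add: AutoGroup_mult)
    qed
    then show "(\<tau>' \<otimes>\<^bsub>A\<^esub> \<sigma>) x = \<one>\<^bsub>A\<^esub> x" using x by (simp add: AutoGroup_one)
  qed
  then show ?thesis unfolding \<tau>'_def using s t A.inv_mult_one_eq[of \<tau> \<sigma>] by simp
qed

lemma label_inner: assumes g: "g \<in> carrier H" shows "tower_label G H (inner_aut H g) = g"
proof -
  have "\<exists>h. h \<in> carrier H \<and> inner_aut H g = inner_aut H h" using g by blast
  then have "(SOME h. h \<in> carrier H \<and> inner_aut H g = inner_aut H h) = g"
    by (metis (mono_tags, lifting) someI_ex H.inner_inj[OF centerless_tower_stage[OF good]] g)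
  then show ?thesis using g by (auto simp: tower_label_def)
qed

lemma label_not_inner:
  assumes "\<not> (\<exists>g\<in>carrier H. \<sigma> = inner_aut H g)"
  shows "tower_label G H \<sigma> = New (\<lambda>a\<in>carrier G. \<sigma> (Base a))"
  using assms by (simp add: tower_label_def)

lemma New_carrier: "New f \<in> carrier H \<Longrightarrow> f = (\<lambda>a\<in>carrier G. inner_aut H (New f) (Base a))"
  using good by (simp add: tower_stage_def)

lemma label_new:
  assumes s: "\<sigma> \<in> auto H" and n: "\<not> (\<exists>g\<in>carrier H. \<sigma> = inner_aut H g)"
  shows "tower_label G H \<sigma> \<notin> carrier H"
proof
  define f where "f = (\<lambda>a\<in>carrier G. \<sigma> (Base a))"
  assume "tower_label G H \<sigma> \<in> carrier H"
  then have c: "New f \<in> carrier H" using n by (simp add: label_not_inner f_def)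
  have "inner_aut H (New f) = \<sigma>"
  proof (rule auto_eq_on_B[OF H.inner_auto[OF c] s])
    fix b assume "b \<in> B"
    then obtain a where "a \<in> carrier G" "b = Base a" by auto
    then show "inner_aut H (New f) b = \<sigma> b"
      using fun_cong[OF New_carrier[OF c], of a] by (simp add: f_def)
  qed
  then show False using n c by auto
qed

lemma label_inj: "inj_on (tower_label G H) (auto H)"
proof (rule inj_onI)
  fix \<sigma> \<tau> assume s: "\<sigma> \<in> auto H" and t: "\<tau> \<in> auto H" and eq: "tower_label G H \<sigma> = tower_label G H \<tau>"
  show "\<sigma> = \<tau>"
  proof (cases "(\<exists>g\<in>carrier H. \<sigma> = inner_aut H g) \<or> (\<exists>g\<in>carrier H. \<tau> = inner_aut H g)")
    case True
    then show ?thesis using eq s t label_new label_inner by metis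
  next
    case False
    then have "(\<lambda>a\<in>carrier G. \<sigma> (Base a)) = (\<lambda>a\<in>carrier G. \<tau> (Base a))"
      using eq by (simp add: label_not_inner)
    then show ?thesis
      by (intro auto_eq_on_B[OF s t]) (metis (no_types, lifting) imageE restrict_apply')
  qed
qed

lemma un_label: "\<sigma> \<in> auto H \<Longrightarrow> un (tower_label G H \<sigma>) = \<sigma>"
  by (rule inv_into_f_f[OF label_inj])

lemma K_carrier: "carrier K = tower_label G H ` auto H" by (simp add: next_group_def Let_def)

lemma label_iso: "tower_label G H \<in> iso A K"
  using A.m_closed by (auto simp: iso_def hom_def bij_betw_def label_inj K_carrier un_label) 
    (simp add: next_group_def Let_def un_label)

lemma K_group: "group K"
proof -
  have "K \<lparr>one := tower_label G H \<one>\<^bsub>A\<^esub>\<rparr> = K" by (simp add: next_group_def Let_def)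
  then show ?thesis using A.iso_imp_img_group[OF label_iso] by simp
qed

sublocale K: group K by (rule K_group)

lemma un_iso: "un \<in> iso K A"
  using A.iso_set_sym[OF label_iso] by simp

lemma un_auto: "k \<in> carrier K \<Longrightarrow> un k \<in> auto H"
  by (auto simp: K_carrier inv_into_into)

lemma label_un: "k \<in> carrier K \<Longrightarrow> tower_label G H (un k) = k"
  by (auto simp: K_carrier f_inv_into_f)

lemma un_mult: "x \<in> carrier K \<Longrightarrow> y \<in> carrier K \<Longrightarrow> un (x \<otimes>\<^bsub>K\<^esub> y) = un x \<otimes>\<^bsub>A\<^esub> un y"
  using un_iso by (simp add: iso_def hom_def)

lemma H_sub_K: "g \<in> carrier H \<Longrightarrow> g \<in> carrier K"
  unfolding K_carrier by (rule image_eqI[of _ _ "inner_aut H g"]) (simp_all add: label_inner H.inner_auto)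

lemma un_H: "g \<in> carrier H \<Longrightarrow> un g = inner_aut H g"
  using un_label[OF H.inner_auto, of g] by (simp add: label_inner)

lemma un_inject: "x \<in> carrier K \<Longrightarrow> y \<in> carrier K \<Longrightarrow> un x = un y \<Longrightarrow> x = y"
  by (metis label_un)

lemma extends_K: "extends H K"
  unfolding extends_def
proof (intro conjI subsetI ballI)
  fix x y assume "x \<in> carrier H" "y \<in> carrier H"
  then show "x \<otimes>\<^bsub>H\<^esub> y = x \<otimes>\<^bsub>K\<^esub> y"
    by (intro un_inject) (simp_all add: H_sub_K un_H H.inner_mult un_mult)
qed (rule H_sub_K)

lemma K_move: "k \<in> carrier K \<Longrightarrow> g \<in> carrier H \<Longrightarrow> k \<otimes>\<^bsub>K\<^esub> g = un k g \<otimes>\<^bsub>K\<^esub> k"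
  by (rule un_inject) (simp_all add: H_sub_K un_auto auto_closed[OF un_auto] un_mult un_H H.auto_inner)

lemma K_conj:
  assumes "k \<in> carrier K" "g \<in> carrier H" shows "k \<otimes>\<^bsub>K\<^esub> g \<otimes>\<^bsub>K\<^esub> inv\<^bsub>K\<^esub> k = un k g"
  using K_move[OF assms] assms by (simp add: H_sub_K auto_closed[OF un_auto] K.m_assoc)

lemma triv_cent_K: "triv_cent K B"
  unfolding triv_cent_def
proof (intro ballI impI)
  fix k assume k: "k \<in> carrier K" and c: "centralizes K B k"
  have "un k = un \<one>\<^bsub>K\<^esub>"
  proof (rule auto_eq_on_B)
    fix b assume b: "b \<in> B"
    have bK: "b \<in> carrier K" using B_sub[OF b] by (rule H_sub_K)
    have "un k b = b"
    proof -
      have "k \<otimes>\<^bsub>K\<^esub> b = b \<otimes>\<^bsub>K\<^esub> k" using c b unfolding centralizes_def by blast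
      then have "k \<otimes>\<^bsub>K\<^esub> b \<otimes>\<^bsub>K\<^esub> inv\<^bsub>K\<^esub> k = b" using k bK by (simp add: K.m_assoc)
      then show ?thesis using K_conj[OF k B_sub[OF b]] by simp
    qed
    moreover have "un \<one>\<^bsub>K\<^esub> b = b" using K_conj[OF K.one_closed B_sub[OF b]] bK by simp
    ultimately show "un k b = un \<one>\<^bsub>K\<^esub> b" by simp
  qed (use k un_auto in auto)
  then show "k = \<one>\<^bsub>K\<^esub>" using k by (auto intro: un_inject)
qed

lemma rigid_K: "rigid B K"
  unfolding rigid_def
proof (intro allI impI ballI)
  fix L :: "'a tower_elt monoid" and \<sigma> k
  assume L: "group L" and KL: "extends K L" and tc: "triv_cent L B" and s: "\<sigma> \<in> hom L L"
    and fx: "\<forall>b\<in>B. \<sigma> b = b" and k: "k \<in> carrier K"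
  interpret L: group L by fact
  have HL: "extends H L" using extends_K KL by (rule extends_trans)
  have r: "\<sigma> h = h" if "h \<in> carrier H" for h
    using good L HL tc s fx that unfolding tower_stage_def rigid_def by blast
  have kL: "k \<in> carrier L" using k KL by (rule extends_carrier[rotated])
  have skL: "\<sigma> k \<in> carrier L" using s kL by (auto simp: hom_def)
  have sm: "\<sigma> (x \<otimes>\<^bsub>L\<^esub> y) = \<sigma> x \<otimes>\<^bsub>L\<^esub> \<sigma> y" if "x \<in> carrier L" "y \<in> carrier L" for x y
    using s that by (auto simp: hom_def)
  have "centralizes L B (inv\<^bsub>L\<^esub> k \<otimes>\<^bsub>L\<^esub> \<sigma> k)"
    unfolding centralizes_def
  proof
    fix b assume b: "b \<in> B"
    have bL: "b \<in> carrier L" using B_sub[OF b] HL by (rule extends_carrier[rotated])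
    define c where "c = un k b"
    have cH: "c \<in> carrier H" using un_auto[OF k] B_sub[OF b] by (simp add: c_def auto_closed)
    have cL: "c \<in> carrier L" using cH HL by (rule extends_carrier[rotated])
    have 1: "k \<otimes>\<^bsub>L\<^esub> b = c \<otimes>\<^bsub>L\<^esub> k"
      using K_move[OF k B_sub[OF b]] extends_mult[OF KL] k H_sub_K[OF B_sub[OF b]] H_sub_K[OF cH]
      by (simp add: c_def)
    then have 2: "\<sigma> k \<otimes>\<^bsub>L\<^esub> b = c \<otimes>\<^bsub>L\<^esub> \<sigma> k"
      using sm[OF kL bL] sm[OF cL kL] r[OF cH] r[OF B_sub[OF b]] by simp
    have 3: "b \<otimes>\<^bsub>L\<^esub> inv\<^bsub>L\<^esub> k = inv\<^bsub>L\<^esub> k \<otimes>\<^bsub>L\<^esub> c"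
    proof -
      have "b \<otimes>\<^bsub>L\<^esub> inv\<^bsub>L\<^esub> k = inv\<^bsub>L\<^esub> k \<otimes>\<^bsub>L\<^esub> (k \<otimes>\<^bsub>L\<^esub> b) \<otimes>\<^bsub>L\<^esub> inv\<^bsub>L\<^esub> k"
        using kL bL by (simp add: L.m_assoc L.conj_cancel)
      also have "\<dots> = inv\<^bsub>L\<^esub> k \<otimes>\<^bsub>L\<^esub> c" unfolding 1 using kL cL by (simp add: L.m_assoc)
      finally show ?thesis .
    qed
    show "inv\<^bsub>L\<^esub> k \<otimes>\<^bsub>L\<^esub> \<sigma> k \<otimes>\<^bsub>L\<^esub> b = b \<otimes>\<^bsub>L\<^esub> (inv\<^bsub>L\<^esub> k \<otimes>\<^bsub>L\<^esub> \<sigma> k)"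
    proof -
      have "inv\<^bsub>L\<^esub> k \<otimes>\<^bsub>L\<^esub> \<sigma> k \<otimes>\<^bsub>L\<^esub> b = inv\<^bsub>L\<^esub> k \<otimes>\<^bsub>L\<^esub> (\<sigma> k \<otimes>\<^bsub>L\<^esub> b)"
        using kL bL skL by (simp add: L.m_assoc)
      also have "\<dots> = (inv\<^bsub>L\<^esub> k \<otimes>\<^bsub>L\<^esub> c) \<otimes>\<^bsub>L\<^esub> \<sigma> k" unfolding 2 using kL cL skL by (simp add: L.m_assoc)
      also have "\<dots> = b \<otimes>\<^bsub>L\<^esub> (inv\<^bsub>L\<^esub> k \<otimes>\<^bsub>L\<^esub> \<sigma> k)"
        unfolding 3[symmetric] using kL bL skL by (simp add: L.m_assoc)
      finally show ?thesis .
    qed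
  qed
  then have "inv\<^bsub>L\<^esub> k \<otimes>\<^bsub>L\<^esub> \<sigma> k = \<one>\<^bsub>L\<^esub>" using tc kL skL by (simp add: triv_cent_def)
  then show "\<sigma> k = k" by (rule L.inv_mult_one_eq[OF kL skL])
qed

lemma tower_stage_K: "tower_stage G K"
  unfolding tower_stage_def
proof (intro conjI allI impI)
  show "group K" by (rule K_group)
  show "extends (base_copy G) K" using good extends_K extends_trans by (auto simp: tower_stage_def)
  show "triv_cent K B" by (rule triv_cent_K)
  show "rigid B K" by (rule rigid_K)
  fix a assume "Base a \<in> carrier K"
  then obtain \<sigma> where s: "\<sigma> \<in> auto H" "Base a = tower_label G H \<sigma>" by (auto simp: K_carrier)
  have "\<exists>g\<in>carrier H. \<sigma> = inner_aut H g"
    by (rule ccontr) (use label_not_inner[of \<sigma>] s(2) in simp)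
  then have "Base a \<in> carrier H" using s(2) label_inner by auto
  then show "a \<in> carrier G" using good by (simp add: tower_stage_def)
next
  fix f assume k: "New f \<in> carrier K"
  have "f = (\<lambda>a\<in>carrier G. un (New f) (Base a))"
  proof (cases "New f \<in> carrier H")
    case True
    then show ?thesis using New_carrier[OF True] by (simp add: un_H)
  next
    case False
    have n: "\<not> (\<exists>g\<in>carrier H. un (New f) = inner_aut H g)"
      using False label_un[OF k] label_inner by metis
    show ?thesis using label_not_inner[OF n] label_un[OF k] by simp
  qed
  moreover have "inner_aut K (New f) (Base a) = un (New f) (Base a)" if "a \<in> carrier G" for a
    using K_conj[OF k] B_sub[of "Base a"] that H_sub_K by (simp add: inner_aut_def)
  ultimately show "f = (\<lambda>a\<in>carrier G. inner_aut K (New f) (Base a))"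
    by (metis (no_types, lifting) restrict_ext)
qed

end

definition union_group :: "('a, 'b) monoid_scheme \<Rightarrow> 'a tower_elt monoid set \<Rightarrow> 'a tower_elt monoid" where
  "union_group G C = \<lparr>carrier = (\<Union>H\<in>C. carrier H),
     mult = \<lambda>x y. SOME z. \<exists>H\<in>C. x \<in> carrier H \<and> y \<in> carrier H \<and> z = x \<otimes>\<^bsub>H\<^esub> y,
     one = Base \<one>\<^bsub>G\<^esub>\<rparr>"

lemma tower_stage_union:
  assumes G: "group G" and ne: "C \<noteq> {}" and good: "\<And>H. H \<in> C \<Longrightarrow> tower_stage G H"
    and chain: "\<And>H K. H \<in> C \<Longrightarrow> K \<in> C \<Longrightarrow> extends H K \<or> extends K H"
  shows "tower_stage G (union_group G C) \<and> (\<forall>H\<in>C. extends H (union_group G C))"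
proof -
  let ?U = "union_group G C"
  have car: "carrier ?U = (\<Union>H\<in>C. carrier H)" by (simp add: union_group_def)
  have mult: "x \<otimes>\<^bsub>?U\<^esub> y = x \<otimes>\<^bsub>H\<^esub> y" if "H \<in> C" "x \<in> carrier H" "y \<in> carrier H" for x y H
  proof -
    have "z = x \<otimes>\<^bsub>H\<^esub> y" if "\<exists>H\<in>C. x \<in> carrier H \<and> y \<in> carrier H \<and> z = x \<otimes>\<^bsub>H\<^esub> y" for z
      using that chain \<open>H \<in> C\<close> \<open>x \<in> carrier H\<close> \<open>y \<in> carrier H\<close> extends_mult by metis
    then have "(SOME z. \<exists>H\<in>C. x \<in> carrier H \<and> y \<in> carrier H \<and> z = x \<otimes>\<^bsub>H\<^esub> y) = x \<otimes>\<^bsub>H\<^esub> y"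
      by (rule some_equality[rotated]) (use that in auto)
    then show ?thesis by (simp add: union_group_def)
  qed
  have ext: "extends H ?U" if "H \<in> C" for H
    using that mult car by (auto simp: extends_def)
  have grp: "group H" if "H \<in> C" for H using good[OF that] by (simp add: tower_stage_def)
  have one: "\<one>\<^bsub>H\<^esub> = \<one>\<^bsub>?U\<^esub>" if "H \<in> C" for H
    using extends_one[of "base_copy G" H] base_copy_group[OF G] good[OF that]
    by (simp add: tower_stage_def base_copy_def union_group_def)
  have two: "\<exists>H\<in>C. x \<in> carrier H \<and> y \<in> carrier H" if "x \<in> carrier ?U" "y \<in> carrier ?U" for x y
    using that chain extends_carrier unfolding car by (metis UN_E)
  have three: "\<exists>H\<in>C. x \<in> carrier H \<and> y \<in> carrier H \<and> z \<in> carrier H"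
    if "x \<in> carrier ?U" "y \<in> carrier ?U" "z \<in> carrier ?U" for x y z
    using two[OF that(1,2)] that(3) chain extends_carrier unfolding car by (metis UN_E)
  have U: "group ?U"
  proof (rule groupI)
    fix x y assume "x \<in> carrier ?U" "y \<in> carrier ?U"
    then obtain H where H: "H \<in> C" "x \<in> carrier H" "y \<in> carrier H" using two by blast
    interpret H: group H by (rule grp[OF H(1)])
    show "x \<otimes>\<^bsub>?U\<^esub> y \<in> carrier ?U" using H mult[OF H] by (auto simp: car)
  next
    obtain H where H: "H \<in> C" using ne by blast
    interpret H: group H by (rule grp[OF H(1)])
    show "\<one>\<^bsub>?U\<^esub> \<in> carrier ?U" using H one[OF H] H.one_closed by (auto simp: car)
  next
    fix x y z assume "x \<in> carrier ?U" "y \<in> carrier ?U" "z \<in> carrier ?U"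
    then obtain H where H: "H \<in> C" "x \<in> carrier H" "y \<in> carrier H" "z \<in> carrier H" using three by blast
    interpret H: group H by (rule grp[OF H(1)])
    show "x \<otimes>\<^bsub>?U\<^esub> y \<otimes>\<^bsub>?U\<^esub> z = x \<otimes>\<^bsub>?U\<^esub> (y \<otimes>\<^bsub>?U\<^esub> z)"
      using H by (simp add: mult[OF H(1)] H.m_assoc)
  next
    fix x assume "x \<in> carrier ?U"
    then obtain H where H: "H \<in> C" "x \<in> carrier H" by (auto simp: car)
    interpret H: group H by (rule grp[OF H(1)])
    show "\<one>\<^bsub>?U\<^esub> \<otimes>\<^bsub>?U\<^esub> x = x"
      using H by (simp add: mult[OF H(1)] flip: one[OF H(1)])
    show "\<exists>y\<in>carrier ?U. y \<otimes>\<^bsub>?U\<^esub> x = \<one>\<^bsub>?U\<^esub>"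
      using H by (intro bexI[of _ "inv\<^bsub>H\<^esub> x"]) (auto simp: mult[OF H(1)] car simp flip: one[OF H(1)])
  qed
  have Bsub: "b \<in> carrier H" if "b \<in> Base ` carrier G" "H \<in> C" for b H
    using good[OF that(2)] that(1) by (auto simp: tower_stage_def extends_def base_copy_def)
  have "extends (base_copy G) ?U" using ne good ext extends_trans unfolding tower_stage_def by blast
  moreover have "triv_cent ?U (Base ` carrier G)"
    unfolding triv_cent_def
  proof (intro ballI impI)
    fix h assume "h \<in> carrier ?U" and c: "centralizes ?U (Base ` carrier G) h"
    then obtain H where H: "H \<in> C" "h \<in> carrier H" by (auto simp: car)
    have "centralizes H (Base ` carrier G) h"
      using c mult[OF H(1)] H Bsub[OF _ H(1)] by (simp add: centralizes_def)
    then show "h = \<one>\<^bsub>?U\<^esub>" using good[OF H(1)] H one[OF H(1)] by (simp add: tower_stage_def triv_cent_def)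
  qed
  moreover have "rigid (Base ` carrier G) ?U"
    unfolding rigid_def
  proof (intro allI impI ballI)
    fix L :: "'a tower_elt monoid" and \<sigma> h
    assume L: "group L" "extends ?U L" "triv_cent L (Base ` carrier G)" "\<sigma> \<in> hom L L"
      "\<forall>b\<in>Base ` carrier G. \<sigma> b = b" and "h \<in> carrier ?U"
    then obtain H where H: "H \<in> C" "h \<in> carrier H" by (auto simp: car)
    have "extends H L" using ext[OF H(1)] L(2) by (rule extends_trans)
    moreover have "rigid (Base ` carrier G) H" using good[OF H(1)] by (simp add: tower_stage_def)
    ultimately show "\<sigma> h = h" using L H(2) unfolding rigid_def by blast
  qed
  moreover have "\<forall>a. Base a \<in> carrier ?U \<longrightarrow> a \<in> carrier G"
    using good by (auto simp: car tower_stage_def)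
  moreover have "f = (\<lambda>a\<in>carrier G. inner_aut ?U (New f) (Base a))" if u: "New f \<in> carrier ?U" for f
  proof -
    obtain H where H: "H \<in> C" "New f \<in> carrier H" using u by (auto simp: car)
    interpret H: group H by (rule grp[OF H(1)])
    have "f = (\<lambda>a\<in>carrier G. inner_aut H (New f) (Base a))" using good[OF H(1)] H by (simp add: tower_stage_def)
    moreover have "inner_aut H (New f) (Base a) = inner_aut ?U (New f) (Base a)" if "a \<in> carrier G" for a
    proof -
      have b: "Base a \<in> carrier H" using Bsub[OF _ H(1)] that by simp
      show ?thesis
        using H b extends_inv[OF ext[OF H(1)] grp[OF H(1)] U H(2)]
          extends_carrier[OF ext[OF H(1)] b]
        by (simp add: inner_aut_def mult[OF H(1)])
    qed
    ultimately show ?thesis by (metis (no_types, lifting) restrict_ext)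
  qed
  ultimately show ?thesis using U ext by (simp add: tower_stage_def)
qed

function tower_group :: "('a, 'b) monoid_scheme \<Rightarrow> 'o :: {wellorder, no_top} \<Rightarrow> 'a tower_elt monoid" where
  "tower_group G \<alpha> = (if is_limit \<alpha> then union_group G (tower_group G ` {..<\<alpha>})
     else if \<exists>\<beta>. \<alpha> = osuc \<beta> then next_group G (tower_group G (THE \<beta>. \<alpha> = osuc \<beta>)) else base_copy G)"
  by pat_completeness auto
termination
  by (relation "inv_image {(\<alpha>, \<beta>). \<alpha> < \<beta>} snd") 
    (auto simp: wf less_osuc osuc_inject intro!: wf_inv_image)

declare tower_group.simps[simp del]

lemma tow_ozero: "tower_group G ozero = base_copy G"
  by (subst tower_group.simps) (simp add: not_limit_ozero osuc_neq_ozero[symmetric])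

lemma tow_osuc: "tower_group G (osuc \<alpha>) = next_group G (tower_group G \<alpha>)"
  by (subst tower_group.simps) (simp add: not_limit_osuc osuc_inject)

lemma tow_limit: "is_limit \<delta> \<Longrightarrow> tower_group G \<delta> = union_group G (tower_group G ` {..<\<delta>})"
  by (subst tower_group.simps) simp

lemma tower_stage_tower:
  assumes "group G" "centerless G"
  shows "tower_stage G (tower_group G \<alpha>) \<and> (\<forall>\<beta><\<alpha>. extends (tower_group G \<beta>) (tower_group G \<alpha>))"
proof (induction \<alpha> rule: less_induct)
  case (less \<alpha>)
  show ?case
  proof (cases \<alpha> rule: ordinal_cases)
    case zero
    then show ?thesis using tower_stage_base[OF assms] by (simp add: tow_ozero ozero_le flip: not_le)
  next
    case (suc \<gamma>)
    have IH: "tower_stage G (tower_group G \<gamma>)" "\<forall>\<beta><\<gamma>. extends (tower_group G \<beta>) (tower_group G \<gamma>)"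
      using less.IH[of \<gamma>] suc less_osuc by auto
    interpret tower_stage_loc G "tower_group G \<gamma>" using IH by unfold_locales
    show ?thesis using tower_stage_K extends_K IH(2) extends_trans
      by (auto simp: suc tow_osuc less_osuc_iff le_less)
  next
    case limit
    have "tower_stage G (union_group G (tower_group G ` {..<\<alpha>})) \<and>
        (\<forall>H\<in>tower_group G ` {..<\<alpha>}. extends H (union_group G (tower_group G ` {..<\<alpha>})))"
    proof (rule tower_stage_union[OF assms(1)])
      show "tower_group G ` {..<\<alpha>} \<noteq> {}" using limit by (auto simp: is_limit_def)
      show "tower_stage G H" if "H \<in> tower_group G ` {..<\<alpha>}" for H using that less.IH by auto
      fix H K assume "H \<in> tower_group G ` {..<\<alpha>}" "K \<in> tower_group G ` {..<\<alpha>}"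
      then obtain \<beta> \<gamma> where "H = tower_group G \<beta>" "K = tower_group G \<gamma>" "\<beta> < \<alpha>" "\<gamma> < \<alpha>" by auto
      then show "extends H K \<or> extends K H"
        using less.IH[of \<beta>] less.IH[of \<gamma>] extends_refl by (metis linorder_less_linear)
    qed
    then show ?thesis using limit by (auto simp: tow_limit)
  qed
qed

theorem is_automorphism_tower:
  fixes G :: "('a, 'b) monoid_scheme"
  assumes "group G" "centerless G"
  shows "is_automorphism_tower G
    (automorphism_tower G :: 'o :: {wellorder, no_top} \<Rightarrow> 'a tower_elt monoid)"
proof -
  have "is_automorphism_tower G (tower_group G :: 'o \<Rightarrow> 'a tower_elt monoid)"
    unfolding is_automorphism_tower_def
  proof (intro conjI allI impI)
    fix \<alpha> :: 'o
    interpret tower_stage_loc G "tower_group G \<alpha>" using tower_stage_tower[OF assms] by unfold_locales blast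
    show "group (tower_group G \<alpha>)" by (rule H.group_axioms)
    show "extends (tower_group G \<alpha>) (tower_group G (osuc \<alpha>))" using extends_K by (simp add: tow_osuc)
    show "\<exists>f\<in>iso (tower_group G (osuc \<alpha>)) (AutoGroup (tower_group G \<alpha>)).
        \<forall>g\<in>carrier (tower_group G \<alpha>). f g = inner_aut (tower_group G \<alpha>) g"
      using un_iso un_H by (auto simp: tow_osuc)
  next
    show "G \<cong> tower_group G ozero" using base_iso by (auto simp: is_iso_def tow_ozero)
  next
    fix \<delta> \<beta> :: 'o assume l: "is_limit \<delta>"
    show "carrier (tower_group G \<delta>) = (\<Union>\<beta>\<in>{..<\<delta>}. carrier (tower_group G \<beta>))"
      by (simp add: tow_limit[OF l] union_group_def)
    show "\<beta> < \<delta> \<Longrightarrow> extends (tower_group G \<beta>) (tower_group G \<delta>)" using tower_stage_tower[OF assms] by blast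
  qed
  then show ?thesis unfolding automorphism_tower_def by (rule someI[where P = "is_automorphism_tower G"])
qed

end

(* A term is a group word in letters for the elements of G and in variables. In every group of the
   tower an element x is determined by the terms that x annihilates: conjugation by an element x of
   Aut(H) maps G into H, so by induction the type of x determines x g x^-1 for all g in G, and
   the centralizer of G is trivial. Hence the tower is coded by the sets X of the types of its finite
   sequences. Such an X determines which countable sequences in H are the images of G under an
   automorphism of H: the sequence must have a back-and-forth property, and the automorphism is
   then the set of the pairs of elements of the same type over G and over the image of G. This makes
   the passage from the X of H to the X of Aut(H) first-order over the given structure, where every
   fixed function on natural numbers is available because its graph is a parameter. *)

theory Submission
  imports Defs "HOL-Library.Nat_Bijection" "HOL-Library.Countable_Set"
begin

section \<open>Definability with parameters\<close>

text \<open>An automorphism of a stage \<open>H\<close> is a subset of \<open>H \<times> H\<close>,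
  and \<open>H\<close> may be uncountable, so it is not an element of the structure; only its
  restriction to the countable group can be a set of numbers. Two difficulties follow. Composition
  applies one automorphism to images under another, which may lie outside the base; there the value
  at \<open>h\<close> is recognised as the only element that has over the image of the base the type
  that \<open>h\<close> has over the base. So the witness for one sequence of the next stage is a
  whole table, with one row of images for every term, whose rows must compose as the terms do.
  Secondly, a row is an infinite sequence, so testing whether it extends needs joint types of
  infinite sequences; these can be rebuilt inside the formula because coherent finite types have
  unique, hence compatible, realizations. The resulting formula contains \<open>X\<close> positively
  and negatively, so no general monotonicity argument applies, and the stages of the induction are
  compared with those of the tower one by one.\<close>

definition fo_definable :: "('s, 'm) struc \<Rightarrow> ('m set \<Rightarrow> (nat \<Rightarrow> 'm) \<Rightarrow> bool) \<Rightarrow> bool" where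
  "fo_definable M Q \<longleftrightarrow> (\<exists>\<phi>. \<forall>X e. sat M X e \<phi> \<longleftrightarrow> Q X e)"

lemma fo_definable_Equal: "fo_definable M (\<lambda>X e. e i = e j)"
  unfolding fo_definable_def by (rule exI[of _ "Equal i j"]) simp

lemma fo_definable_Rel: "fo_definable M (\<lambda>X e. M s (map e js))"
  unfolding fo_definable_def by (rule exI[of _ "Rel s js"]) simp

lemma fo_definable_InX: "fo_definable M (\<lambda>X e. e i \<in> X)"
  unfolding fo_definable_def by (rule exI[of _ "InX i"]) simp

lemma fo_definable_not: "fo_definable M P \<Longrightarrow> fo_definable M (\<lambda>X e. \<not> P X e)"
  unfolding fo_definable_def by (elim exE, rule_tac x = "Neg \<phi>" in exI) simp

lemma fo_definable_conj:
  assumes "fo_definable M P" "fo_definable M Q" shows "fo_definable M (\<lambda>X e. P X e \<and> Q X e)"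
proof -
  obtain \<phi> \<psi> where "\<forall>X e. sat M X e \<phi> \<longleftrightarrow> P X e" "\<forall>X e. sat M X e \<psi> \<longleftrightarrow> Q X e"
    using assms by (auto simp: fo_definable_def)
  then show ?thesis unfolding fo_definable_def by (intro exI[of _ "Conj \<phi> \<psi>"]) simp
qed

lemma fo_definable_ex:
  assumes "fo_definable M P" shows "fo_definable M (\<lambda>X e. \<exists>a. P X (e(i := a)))"
proof -
  obtain \<phi> where "\<forall>X e. sat M X e \<phi> \<longleftrightarrow> P X e" using assms by (auto simp: fo_definable_def)
  then show ?thesis unfolding fo_definable_def by (intro exI[of _ "Ex i \<phi>"]) simp
qed

text \<open>Needed for fresh variables: the range of a renaming may be all of the naturals, but a
  bound variable has to avoid only the image of a finite support.\<close>

lemma sat_finite_support: "\<exists>n. \<forall>X e e'. (\<forall>i<n. e i = e' i) \<longrightarrow> sat M X e \<phi> = sat M X e' \<phi>"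
proof (induction \<phi>)
  case (Equal i j)
  show ?case by (rule exI[of _ "Suc (max i j)"]) auto
next
  case (Rel s js)
  have "sat M X e (Rel s js) = sat M X e' (Rel s js)" if "\<forall>i<Suc (sum_list js). e i = e' i" for X e e'
  proof -
    have "map e js = map e' js" using that member_le_sum_list by (auto simp: less_Suc_eq_le)
    then show ?thesis by (simp only: sat.simps)
  qed
  then show ?case by blast
next
  case (InX i)
  show ?case by (rule exI[of _ "Suc i"]) auto
next
  case (Neg \<phi>)
  then show ?case by simp
next
  case (Conj \<phi> \<psi>)
  then obtain m n where Conj:
    "\<forall>X e e'. (\<forall>i<m. e i = e' i) \<longrightarrow> sat M X e \<phi> = sat M X e' \<phi>"
    "\<forall>X e e'. (\<forall>i<n. e i = e' i) \<longrightarrow> sat M X e \<psi> = sat M X e' \<psi>" by blast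
  have "sat M X e (Conj \<phi> \<psi>) = sat M X e' (Conj \<phi> \<psi>)" if "\<forall>i<max m n. e i = e' i" for X e e'
  proof -
    have "sat M X e \<phi> = sat M X e' \<phi>" "sat M X e \<psi> = sat M X e' \<psi>"
      using Conj that by (simp_all add: less_max_iff_disj)
    then show ?thesis by (simp only: sat.simps)
  qed
  then show ?case by blast
next
  case (Ex i \<phi>)
  then obtain n where n: "\<forall>X e e'. (\<forall>i<n. e i = e' i) \<longrightarrow> sat M X e \<phi> = sat M X e' \<phi>" by blast
  have *: "sat M X (e(i := a)) \<phi> = sat M X (e'(i := a)) \<phi>" if "\<forall>i<n. e i = e' i" for X e e' a
    by (rule n[rule_format]) (use that in auto)
  have "sat M X e (Ex i \<phi>) = sat M X e' (Ex i \<phi>)" if "\<forall>i<n. e i = e' i" for X e e'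
    unfolding sat.simps by (simp only: *[OF that])
  then show ?case by blast
qed

text \<open>Capture is the only danger: in the case of \<open>Ex\<close> the bound variable is moved
  to a \<open>k\<close> outside the image of the support, so the induction runs over all renamings,
  \<open>r(i := k)\<close> included.\<close>

lemma sat_rename: "\<exists>\<psi>. \<forall>X e. sat M X e \<psi> = sat M X (e \<circ> r) \<phi>"
proof (induction \<phi> arbitrary: r)
  case (Equal i j)
  show ?case by (rule exI[of _ "Equal (r i) (r j)"]) simp
next
  case (Rel s js)
  show ?case by (rule exI[of _ "Rel s (map r js)"]) (simp add: comp_def)
next
  case (InX i)
  show ?case by (rule exI[of _ "InX (r i)"]) simp
next
  case (Neg \<phi>)
  then show ?case by (metis sat.simps(4))
next
  case (Conj \<phi> \<psi>)
  then show ?case by (metis sat.simps(5))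
next
  case (Ex i \<phi>)
  obtain n where n: "\<forall>X e e'. (\<forall>i<n. e i = e' i) \<longrightarrow> sat M X e \<phi> = sat M X e' \<phi>"
    using sat_finite_support by blast
  obtain k where k: "k \<notin> r ` {..<n}" using ex_new_if_finite[OF infinite_UNIV_nat, of "r ` {..<n}"] by auto
  obtain \<psi> where \<psi>: "\<forall>X e. sat M X e \<psi> = sat M X (e \<circ> r(i := k)) \<phi>" using Ex.IH by blast
  have "sat M X (e(k := a) \<circ> r(i := k)) \<phi> = sat M X ((e \<circ> r)(i := a)) \<phi>" for X e a
    by (rule n[rule_format]) (use k in auto)
  then show ?case using \<psi> by (intro exI[of _ "Ex k \<psi>"]) (simp add: comp_def)
qed

lemma fo_definable_rename:
  assumes "fo_definable M P" shows "fo_definable M (\<lambda>X e. P X (e \<circ> r))"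
proof -
  obtain \<phi> where "\<forall>X e. sat M X e \<phi> \<longleftrightarrow> P X e" using assms by (auto simp: fo_definable_def)
  moreover obtain \<psi> where "\<forall>X e. sat M X e \<psi> = sat M X (e \<circ> r) \<phi>" using sat_rename by blast
  ultimately show ?thesis unfolding fo_definable_def by (intro exI[of _ \<psi>]) simp
qed

text \<open>The residues modulo 3 give each sort of variable an infinite supply of slots in a single
  assignment.\<close>

definition slots :: "(nat \<Rightarrow> 'a) \<Rightarrow> (nat \<Rightarrow> 'a) \<Rightarrow> (nat \<Rightarrow> 'a) \<Rightarrow> nat \<Rightarrow> 'a" where
  "slots f g h i =
    (if i mod 3 = 0 then f (i div 3) else if i mod 3 = 1 then g (i div 3) else h (i div 3))"

lemma slots_simps [simp]:
  "slots f g h (3 * i) = f i" "slots f g h (Suc (3 * i)) = g i" "slots f g h (Suc (Suc (3 * i))) = h i"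
proof -
  have "Suc (3 * i) div 3 = i" "Suc (Suc (3 * i)) div 3 = i" "Suc (3 * i) mod 3 = 1" "Suc (Suc (3 * i)) mod 3 = 2"
    by presburger+
  then show "slots f g h (3 * i) = f i" "slots f g h (Suc (3 * i)) = g i" "slots f g h (Suc (Suc (3 * i))) = h i"
    by (simp_all add: slots_def)
qed

lemma slots_cong:
  "(\<And>i. f i = f' i) \<Longrightarrow> (\<And>i. g i = g' i) \<Longrightarrow> (\<And>i. h i = h' i) \<Longrightarrow> slots f g h = slots f' g' h'"
  by (auto simp: slots_def)

text \<open>Slot 2 is the place of parameter number 0. The quantifier rules free it for the bound
  variable, and no other slot changes.\<close>

lemma slots_upd_2:
  fixes f :: "nat \<Rightarrow> 'a"
  shows "(f(2 := a)) (3 * i) = f (3 * i)" "(f(2 := a)) (Suc (3 * i)) = f (Suc (3 * i))"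
    "(f(2 := a)) (Suc (Suc (3 * Suc i))) = f (Suc (Suc (3 * Suc i)))"
  by (rule fun_upd_other, presburger)+

lemma comp_slots: "e \<circ> slots f g h = slots (\<lambda>i. e (f i)) (\<lambda>i. e (g i)) (\<lambda>i. e (h i))"
  by (auto simp: slots_def)

abbreviation valuation :: "(nat \<Rightarrow> nat) \<Rightarrow> (nat \<Rightarrow> nat set) \<Rightarrow> (nat \<Rightarrow> nat set) \<Rightarrow> nat \<Rightarrow> nat + nat set" where
  "valuation u v w \<equiv> slots (\<lambda>i. Inl (u i)) (\<lambda>i. Inr (v i)) (\<lambda>i. Inr (w i))"

section \<open>Two-sorted definability over numbers and sets of numbers\<close>

context
  fixes G :: "nat monoid"
begin

text \<open>The variables of sort \<open>\<omega>\<close> are \<open>u\<close>, those of sort \<open>\<P>(\<omega>)\<close> are \<open>v\<close>, and the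
  parameters are \<open>w\<close>.\<close>

definition definable ::
  "((nat + nat set) set \<Rightarrow> (nat \<Rightarrow> nat) \<Rightarrow> (nat \<Rightarrow> nat set) \<Rightarrow> bool) \<Rightarrow> bool" where
  "definable P \<longleftrightarrow> (\<exists>Q w. fo_definable (arith_struc G) Q \<and> (\<forall>X u v. P X u v \<longleftrightarrow> Q X (valuation u v w)))"

lemma definable_not:
  assumes "definable P" shows "definable (\<lambda>X u v. \<not> P X u v)"
proof -
  obtain Q w where "fo_definable (arith_struc G) Q" "\<forall>X u v. P X u v \<longleftrightarrow> Q X (valuation u v w)"
    using assms by (auto simp: definable_def)
  then show ?thesis unfolding definable_def
    by (intro exI[of _ "\<lambda>X e. \<not> Q X e"] exI[of _ w]) (simp add: fo_definable_not)
qed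

lemma definable_conj:
  assumes "definable P" "definable Q" shows "definable (\<lambda>X u v. P X u v \<and> Q X u v)"
proof -
  obtain P' w where P: "fo_definable (arith_struc G) P'" "\<And>X u v. P X u v \<longleftrightarrow> P' X (valuation u v w)"
    using assms(1) by (auto simp: definable_def)
  obtain Q' w' where Q: "fo_definable (arith_struc G) Q'" "\<And>X u v. Q X u v \<longleftrightarrow> Q' X (valuation u v w')"
    using assms(2) by (auto simp: definable_def)
  \<comment> \<open>The two formulas come with different parameter sequences. These are interleaved,
    and \<open>?r 0\<close> and \<open>?r 1\<close> send each formula to its own half.\<close>
  define w'' where "w'' i = (if even i then w (i div 2) else w' (i div 2))" for i
  let ?r = "\<lambda>n. slots (\<lambda>i. 3 * i) (\<lambda>i. Suc (3 * i)) (\<lambda>i. Suc (Suc (3 * (2 * i + n))))"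
  have "valuation u v w'' \<circ> ?r 0 = valuation u v w" "valuation u v w'' \<circ> ?r 1 = valuation u v w'" for u v
    unfolding comp_slots slots_simps by (simp_all add: w''_def)
  then have "P X u v \<and> Q X u v \<longleftrightarrow>
      P' X (valuation u v w'' \<circ> ?r 0) \<and> Q' X (valuation u v w'' \<circ> ?r 1)" for X u v
    unfolding P Q by (simp only:)
  moreover have "fo_definable (arith_struc G) (\<lambda>X e. P' X (e \<circ> ?r 0) \<and> Q' X (e \<circ> ?r 1))"
    by (intro fo_definable_conj fo_definable_rename P(1) Q(1))
  ultimately show ?thesis unfolding definable_def
    by (intro exI[of _ "\<lambda>X e. P' X (e \<circ> ?r 0) \<and> Q' X (e \<circ> ?r 1)"] exI[of _ w'']) blast
qed

lemma definable_disj: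
  assumes "definable P" "definable Q" shows "definable (\<lambda>X u v. P X u v \<or> Q X u v)"
proof -
  have "definable (\<lambda>X u v. \<not> (\<not> P X u v \<and> \<not> Q X u v))"
    by (intro definable_not definable_conj assms)
  then show ?thesis by simp
qed

lemma definable_imp:
  assumes "definable P" "definable Q" shows "definable (\<lambda>X u v. P X u v \<longrightarrow> Q X u v)"
proof -
  have "definable (\<lambda>X u v. \<not> P X u v \<or> Q X u v)"
    by (intro definable_not definable_disj assms)
  then show ?thesis by simp
qed

lemma definable_iff: "definable P \<Longrightarrow> definable Q \<Longrightarrow> definable (\<lambda>X u v. P X u v \<longleftrightarrow> Q X u v)"
  unfolding iff_conv_conj_imp by (intro definable_conj definable_imp)

lemma definable_rename:
  assumes "definable P" shows "definable (\<lambda>X u v. P X (\<lambda>i. u (f i)) (\<lambda>i. v (g i)))"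
proof -
  obtain P' w where P: "fo_definable (arith_struc G) P'" "\<And>X u v. P X u v \<longleftrightarrow> P' X (valuation u v w)"
    using assms(1) by (auto simp: definable_def)
  let ?r = "slots (\<lambda>i. 3 * f i) (\<lambda>i. Suc (3 * g i)) (\<lambda>i. Suc (Suc (3 * i)))"
  show ?thesis unfolding definable_def P
    by (intro exI[of _ "\<lambda>X e. P' X (e \<circ> ?r)"] exI[of _ w] conjI fo_definable_rename P(1))
      (simp add: comp_slots)
qed

text \<open>There is no sort predicate, but the graph of addition contains numbers only, and
  \<open>x + x\<close> always exists.\<close>

lemma fo_definable_isNat: "fo_definable (arith_struc G) (\<lambda>X e. \<exists>n. e i = Inl n)"
proof -
  have "fo_definable (arith_struc G) (\<lambda>X e. \<exists>a. arith_struc G Plus (map (e(Suc i := a)) [i, i, Suc i]))"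
    by (rule fo_definable_ex[OF fo_definable_Rel])
  then show ?thesis by (rule back_subst[of "fo_definable _"]) (auto simp: fun_eq_iff)
qed

text \<open>The place of a dummy parameter is taken by the bound variable.\<close>

lemma definable_exN:
  assumes "definable (\<lambda>X u v. P X (u 0) (\<lambda>i. u (Suc i)) v)"
  shows "definable (\<lambda>X u v. \<exists>a. P X a u v)"
proof -
  obtain Q w where Q: "fo_definable (arith_struc G) Q"
    "\<And>X u v. P X (u 0) (\<lambda>i. u (Suc i)) v \<longleftrightarrow> Q X (valuation u v w)"
    using assms by (auto simp: definable_def)
  define w' where "w' = case_nat {} w"
  let ?r = "slots (case_nat 2 (\<lambda>i. 3 * i)) (\<lambda>i. Suc (3 * i)) (\<lambda>i. Suc (Suc (3 * Suc i)))"
  let ?Q = "\<lambda>X e. (\<exists>n. e 2 = Inl n) \<and> Q X (e \<circ> ?r)"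
  have v: "(valuation u v w')(2 := a) \<circ> ?r = slots (case_nat a (\<lambda>i. Inl (u i))) (\<lambda>i. Inr (v i)) (\<lambda>i. Inr (w i))"
    for u v a
    unfolding comp_slots
    by (rule slots_cong)
      (simp_all only: slots_upd_2 slots_simps w'_def nat.case fun_upd_same split: nat.split, auto simp: slots_upd_2)
  have v': "slots (case_nat (Inl a) (\<lambda>i. Inl (u i))) (\<lambda>i. Inr (v i)) (\<lambda>i. Inr (w i)) = valuation (case_nat a u) v w" for u v a
    by (rule slots_cong) (auto split: nat.split)
  have "fo_definable (arith_struc G) ?Q"
    by (intro fo_definable_conj fo_definable_isNat fo_definable_rename Q)
  then have "fo_definable (arith_struc G) (\<lambda>X e. \<exists>a. ?Q X (e(2 := a)))" by (rule fo_definable_ex)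
  moreover have "(\<exists>a. P X a u v) \<longleftrightarrow> (\<exists>a. ?Q X ((valuation u v w')(2 := a)))" for X u v
  proof -
    have "P X a u v \<longleftrightarrow> Q X (valuation (case_nat a u) v w)" for a
      using Q(2)[of X "case_nat a u" v] by simp
    then show ?thesis unfolding v fun_upd_same v'[symmetric] by blast
  qed
  ultimately show ?thesis unfolding definable_def by blast
qed

text \<open>Whatever is not a number is a set, so the quantifier is relativized by a negation.
  Variables are counted as de Bruijn indices: the bound set is \<open>v 0\<close>, and the others
  shift by one.\<close>

lemma definable_exS:
  assumes "definable (\<lambda>X u v. P X (v 0) u (\<lambda>i. v (Suc i)))"
  shows "definable (\<lambda>X u v. \<exists>A. P X A u v)"
proof -
  obtain Q w where Q: "fo_definable (arith_struc G) Q"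
    "\<And>X u v. P X (v 0) u (\<lambda>i. v (Suc i)) \<longleftrightarrow> Q X (valuation u v w)"
    using assms by (auto simp: definable_def)
  define w' where "w' = case_nat {} w"
  let ?r = "slots (\<lambda>i. 3 * i) (case_nat 2 (\<lambda>i. Suc (3 * i))) (\<lambda>i. Suc (Suc (3 * Suc i)))"
  let ?Q = "\<lambda>X e. \<not> (\<exists>n. e 2 = Inl n) \<and> Q X (e \<circ> ?r)"
  have v: "(valuation u v w')(2 := a) \<circ> ?r = slots (\<lambda>i. Inl (u i)) (case_nat a (\<lambda>i. Inr (v i))) (\<lambda>i. Inr (w i))"
    for u v a
    unfolding comp_slots
    by (rule slots_cong)
      (simp_all only: slots_upd_2 slots_simps w'_def nat.case fun_upd_same split: nat.split, auto simp: slots_upd_2)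
  have v': "slots (\<lambda>i. Inl (u i)) (case_nat (Inr a) (\<lambda>i. Inr (v i))) (\<lambda>i. Inr (w i)) = valuation u (case_nat a v) w" for u v a
    by (rule slots_cong) (auto split: nat.split)
  have "fo_definable (arith_struc G) ?Q"
    by (intro fo_definable_conj fo_definable_not fo_definable_isNat fo_definable_rename Q)
  then have "fo_definable (arith_struc G) (\<lambda>X e. \<exists>a. ?Q X (e(2 := a)))" by (rule fo_definable_ex)
  moreover have "(\<exists>a. P X a u v) \<longleftrightarrow> (\<exists>a. ?Q X ((valuation u v w')(2 := a)))" for X u v
  proof -
    have P: "P X a u v \<longleftrightarrow> Q X (valuation u (case_nat a v) w)" for a
      using Q(2)[where X = X and u = u and v = "case_nat a v"] by simp
    have "\<not> (\<exists>n. a = Inl n) \<longleftrightarrow> (\<exists>A. a = Inr A)" for a :: "nat + nat set" by (cases a) auto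
    then show ?thesis unfolding v fun_upd_same P v'[symmetric] by (simp only:) blast
  qed
  ultimately show ?thesis unfolding definable_def by blast
qed

lemma definable_allN:
  assumes "definable (\<lambda>X u v. P X (u 0) (\<lambda>i. u (Suc i)) v)"
  shows "definable (\<lambda>X u v. \<forall>a. P X a u v)"
proof -
  have "definable (\<lambda>X u v. \<not> (\<exists>a. \<not> P X a u v))"
    by (intro definable_not definable_exN assms)
  then show ?thesis by simp
qed

lemma definable_allS:
  assumes "definable (\<lambda>X u v. P X (v 0) u (\<lambda>i. v (Suc i)))"
  shows "definable (\<lambda>X u v. \<forall>A. P X A u v)"
proof -
  have "definable (\<lambda>X u v. \<not> (\<exists>A. \<not> P X A u v))"
    by (intro definable_not definable_exS assms)
  then show ?thesis by simp
qed

lemma definable_fo: "fo_definable (arith_struc G) Q \<Longrightarrow> definable (\<lambda>X u v. Q X (valuation u v w))"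
  unfolding definable_def by blast

lemma definable_eq_var: "definable (\<lambda>X u v. u i = u j)"
  using definable_fo[OF fo_definable_Equal[of _ "3 * i" "3 * j"]] by simp

lemma definable_plus_var: "definable (\<lambda>X u v. u k = u i + u j)"
  using definable_fo[OF fo_definable_Rel[of _ Plus "[3 * i, 3 * j, 3 * k]"]] by simp

lemma definable_times_var: "definable (\<lambda>X u v. u k = u i * u j)"
  using definable_fo[OF fo_definable_Rel[of _ Times "[3 * i, 3 * j, 3 * k]"]] by simp

lemma definable_mem_var: "definable (\<lambda>X u v. u i \<in> v j)"
  using definable_fo[OF fo_definable_Rel[of _ Member "[3 * i, Suc (3 * j)]"]] by simp

lemma definable_param: "definable (\<lambda>X u v. u i \<in> S)"
  using definable_fo[OF fo_definable_Rel[of _ Member "[3 * i, Suc (Suc (3 * 0))]"], of "\<lambda>_. S"]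
  unfolding list.map slots_simps by simp

lemma definable_InX: "definable (\<lambda>X u v. Inr (v i) \<in> X)"
  using definable_fo[OF fo_definable_InX[of _ "Suc (3 * i)"]] by simp

text \<open>Formulas have no function symbols, so an expression is treated through its graph, with
  the value in \<open>u 0\<close>.\<close>

definition definable_term ::
  "((nat + nat set) set \<Rightarrow> (nat \<Rightarrow> nat) \<Rightarrow> (nat \<Rightarrow> nat set) \<Rightarrow> nat) \<Rightarrow> bool" where
  "definable_term t \<longleftrightarrow> definable (\<lambda>X u v. u 0 = t X (\<lambda>i. u (Suc i)) v)"

lemma definable_subst:
  assumes "definable_term t" "definable (\<lambda>X u v. P X (u 0) (\<lambda>i. u (Suc i)) v)"
  shows "definable (\<lambda>X u v. P X (t X u v) u v)"
proof -
  have "definable (\<lambda>X u v. \<exists>a. a = t X u v \<and> P X a u v)"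
    using assms unfolding definable_term_def by (intro definable_exN definable_conj)
  then show ?thesis by simp
qed

lemma definable_term_weaken:
  "definable_term t \<Longrightarrow> definable_term (\<lambda>X u v. t X (\<lambda>i. u (Suc i)) v)"
  unfolding definable_term_def
  by (drule definable_rename[where f = "case_nat 0 (\<lambda>i. Suc (Suc i))" and g = "\<lambda>i. i"]) simp

lemma definable_term_var: "definable_term (\<lambda>X u v. u i)"
  unfolding definable_term_def by (rule definable_eq_var)

lemma definable_term_subst:
  assumes "definable_term t" "definable_term (\<lambda>X u v. f X (u 0) (\<lambda>i. u (Suc i)) v)"
  shows "definable_term (\<lambda>X u v. f X (t X u v) u v)"
proof -
  \<comment> \<open>The value of \<open>t\<close> is bound as a new \<open>u 0\<close>, which pushes
    the result of \<open>f\<close> to \<open>u 1\<close>; the renaming exchanges the two.\<close>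
  have "definable (\<lambda>X u v. u 1 = f X (u 0) (\<lambda>i. u (Suc (Suc i))) v)"
    using definable_rename[OF assms(2)[unfolded definable_term_def],
      where f = "case_nat 1 (case_nat 0 (\<lambda>i. Suc (Suc i)))" and g = "\<lambda>i. i"] by simp
  then show ?thesis unfolding definable_term_def
    by (intro definable_subst[OF definable_term_weaken[OF assms(1)],
      where P = "\<lambda>X a u v. u 0 = f X a (\<lambda>i. u (Suc i)) v"]) simp
qed

lemma definable_term_plus:
  assumes "definable_term s" "definable_term t"
  shows "definable_term (\<lambda>X u v. s X u v + t X u v)"
  using definable_plus_var
  by (intro definable_term_subst[OF assms(1), where f = "\<lambda>X a u v. a + t X u v"]
      definable_term_subst[OF definable_term_weaken[OF assms(2)], where f = "\<lambda>X a u v. u 0 + a"])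
    (simp add: definable_term_def)

lemma definable_term_times:
  assumes "definable_term s" "definable_term t"
  shows "definable_term (\<lambda>X u v. s X u v * t X u v)"
  using definable_times_var
  by (intro definable_term_subst[OF assms(1), where f = "\<lambda>X a u v. a * t X u v"]
      definable_term_subst[OF definable_term_weaken[OF assms(2)], where f = "\<lambda>X a u v. u 0 * a"])
    (simp add: definable_term_def)

lemma definable_term_const: "definable_term (\<lambda>X u v. c)"
  using definable_param[of 0 "{c}"] by (simp add: definable_term_def)

lemma definable_eq:
  assumes "definable_term s" "definable_term t"
  shows "definable (\<lambda>X u v. s X u v = t X u v)"
  using definable_eq_var
  by (intro definable_subst[OF assms(1), where P = "\<lambda>X a u v. a = t X u v"]
      definable_subst[OF definable_term_weaken[OF assms(2)], where P = "\<lambda>X a u v. u 0 = a"])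

lemma definable_mem:
  assumes "definable_term t" shows "definable (\<lambda>X u v. t X u v \<in> v i)"
  by (rule definable_subst[OF assms]) (rule definable_mem_var)

lemma definable_rel:
  assumes "definable_term t" shows "definable (\<lambda>X u v. R (t X u v))"
  using definable_subst[OF assms, of "\<lambda>X a u v. a \<in> Collect R", OF definable_param] by simp

text \<open>Doubling Cantor's formula removes the division in \<open>triangle\<close> and leaves an
  equation in \<open>+\<close> and \<open>*\<close>. With pairs available, a relation of several
  arguments is a set of numbers and can serve as a parameter.\<close>

lemma definable_term_pair:
  assumes "definable_term s" "definable_term t"
  shows "definable_term (\<lambda>X u v. prod_encode (s X u v, t X u v))"
proof -
  have eq: "c = prod_encode (a, b) \<longleftrightarrow> c + c = (a + b) * (a + b + 1) + (a + a)" for a b c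
  proof -
    have "triangle (a + b) + triangle (a + b) = (a + b) * (a + b + 1)"
    proof -
      have "2 dvd (a + b) * Suc (a + b)" by simp
      then have "2 * triangle (a + b) = (a + b) * Suc (a + b)"
        unfolding triangle_def by (rule dvd_mult_div_cancel)
      then show ?thesis by simp
    qed
    moreover have "c = t + a \<longleftrightarrow> c + c = d + (a + a)" if "t + t = d" for t d :: nat
      using that by auto
    ultimately show ?thesis unfolding prod_encode_def split_conv by blast
  qed
  have "definable (\<lambda>X u v. u 2 = prod_encode (u 0, u 1))" (is "definable ?P")
    unfolding eq
    by (intro definable_eq definable_term_plus definable_term_times definable_term_var definable_term_const)
  then have 1: "definable_term (\<lambda>X u v. prod_encode (u 1, u 0))"
    unfolding definable_term_def
    by (drule_tac definable_rename[where f = "case_nat 2 (case_nat 1 (case_nat 0 (\<lambda>i. i)))" and g = "\<lambda>i. i"])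
      (simp add: numeral_2_eq_2)
  show ?thesis using 1
    by (intro definable_term_subst[OF assms(1), where f = "\<lambda>X a u v. prod_encode (a, t X u v)"]
      definable_term_subst[OF definable_term_weaken[OF assms(2)], where f = "\<lambda>X a u v. prod_encode (u 0, a)"])
      simp
qed

text \<open>Its graph is a parameter.\<close>

lemma definable_term_app:
  assumes "definable_term t" shows "definable_term (\<lambda>X u v. f (t X u v))"
proof (rule definable_term_subst[OF assms])
  have "definable (\<lambda>X u v. (case prod_decode (prod_encode (u 0, u 1)) of (b, a) \<Rightarrow> b = f a))"
    by (rule definable_rel[OF definable_term_pair[OF definable_term_var definable_term_var]])
  then show "definable_term (\<lambda>X u v. f (u 0))" by (simp add: definable_term_def)
qed

lemma definable_term_app2:
  assumes "definable_term s" "definable_term t" shows "definable_term (\<lambda>X u v. f (s X u v) (t X u v))"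
  using definable_term_app[OF definable_term_pair[OF assms], of "\<lambda>n. case prod_decode n of (a, b) \<Rightarrow> f a b"] by simp

lemma definable_term_app3:
  assumes "definable_term s" "definable_term t" "definable_term r"
  shows "definable_term (\<lambda>X u v. f (s X u v) (t X u v) (r X u v))"
  using definable_term_app2[OF definable_term_pair[OF assms(1,2)] assms(3),
    of "\<lambda>n c. case prod_decode n of (a, b) \<Rightarrow> f a b c"] by simp

lemma definable_rel2:
  assumes "definable_term s" "definable_term t" shows "definable (\<lambda>X u v. R (s X u v) (t X u v))"
  using definable_rel[OF definable_term_pair[OF assms], of "\<lambda>n. case prod_decode n of (a, b) \<Rightarrow> R a b"] by simp

text \<open>\<open>formula_set\<close> reserves variable 0 for its argument, which is a number slot
  in \<open>slots\<close>. Hence \<open>v 0\<close> is read from variable 0 and all number slots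
  move up by one.\<close>

lemma definable_formula_set:
  assumes "definable (\<lambda>X u v. P X (v 0))"
  shows "\<exists>\<phi> p. \<forall>X. formula_set (arith_struc G) \<phi> p X = Inr ` {A. P X A}"
proof -
  obtain Q w where Q: "fo_definable (arith_struc G) Q" "\<And>X u v. P X (v 0) \<longleftrightarrow> Q X (valuation u v w)"
    using assms by (auto simp: definable_def)
  let ?r = "slots (\<lambda>i. 3 * Suc i) (case_nat 0 (\<lambda>i. Suc (3 * i))) (\<lambda>i. Suc (Suc (3 * i)))"
  define p where "p = valuation (\<lambda>_. 0) (\<lambda>_. {}) w"
  have "fo_definable (arith_struc G) (\<lambda>X e. \<not> (\<exists>n. e 0 = Inl n) \<and> Q X (e \<circ> ?r))"
    by (intro fo_definable_conj fo_definable_not fo_definable_isNat fo_definable_rename Q)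
  then obtain \<phi> where \<phi>: "\<And>X e. sat (arith_struc G) X e \<phi> \<longleftrightarrow> \<not> (\<exists>n. e 0 = Inl n) \<and> Q X (e \<circ> ?r)"
    unfolding fo_definable_def by blast
  have "p(0 := Inr A) \<circ> ?r = valuation (\<lambda>_. 0) (case_nat A (\<lambda>_. {})) w" for A
    unfolding comp_slots p_def fun_upd_apply slots_simps
    by (rule slots_cong) (auto split: nat.split)
  then have "Q X (p(0 := Inr A) \<circ> ?r) \<longleftrightarrow> P X A" for X A
    using Q(2)[of X "case_nat A (\<lambda>_. {})"] by simp
  then have "x \<in> formula_set (arith_struc G) \<phi> p X \<longleftrightarrow> x \<in> Inr ` {A. P X A}" for x X
    unfolding formula_set_def mem_Collect_eq \<phi> fun_upd_same by (cases x) auto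
  then show ?thesis by blast
qed

end

section \<open>Group terms and types over a base\<close>

datatype trm = Cst nat | Var nat | Mul trm trm | Inv trm

instance trm :: countable by countable_datatype

definition code :: "trm \<Rightarrow> nat" where "code = to_nat_on UNIV"

definition decode :: "nat \<Rightarrow> trm" where "decode = from_nat_into UNIV"

lemma decode_code [simp]: "decode (code t) = t"
  by (simp add: code_def decode_def)

text \<open>The coding must be onto: the formulas quantify over all numbers, and each of them has to
  stand for a term.\<close>

lemma code_decode [simp]: "code (decode n) = n"
proof -
  have "infinite (range Cst)" by (simp add: finite_image_iff inj_on_def)
  then have "infinite (UNIV :: trm set)" by (rule infinite_super[OF subset_UNIV])
  then show ?thesis by (simp add: code_def decode_def to_nat_on_from_nat_into_infinite)
qed

primrec ev :: "('a, 'b) monoid_scheme \<Rightarrow> (nat \<Rightarrow> 'a) \<Rightarrow> (nat \<Rightarrow> 'a) \<Rightarrow> trm \<Rightarrow> 'a" where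
  "ev H b s (Cst c) = b c"
| "ev H b s (Var i) = s i"
| "ev H b s (Mul t u) = ev H b s t \<otimes>\<^bsub>H\<^esub> ev H b s u"
| "ev H b s (Inv t) = inv\<^bsub>H\<^esub> (ev H b s t)"

text \<open>Letters are replaced too, so that a substitution can change the base over which a type
  is read, as in \<open>even_code\<close> and \<open>target_code\<close>.\<close>

primrec sub :: "(nat \<Rightarrow> trm) \<Rightarrow> (nat \<Rightarrow> trm) \<Rightarrow> trm \<Rightarrow> trm" where
  "sub f g (Cst c) = f c"
| "sub f g (Var i) = g i"
| "sub f g (Mul t u) = Mul (sub f g t) (sub f g u)"
| "sub f g (Inv t) = Inv (sub f g t)"

lemma ev_sub: "ev H b s (sub f g t) = ev H (\<lambda>c. ev H b s (f c)) (\<lambda>i. ev H b s (g i)) t"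
  by (induction t) simp_all

lemma (in group) ev_closed:
  "(\<And>c. b c \<in> carrier G) \<Longrightarrow> (\<And>i. s i \<in> carrier G) \<Longrightarrow> ev G b s t \<in> carrier G"
  by (induction t) simp_all

lemma ev_extends:
  assumes "extends H K" "group H" "group K" "\<And>c. b c \<in> carrier H" "\<And>i. s i \<in> carrier H"
  shows "ev K b s t = ev H b s t"
proof (induction t)
  case (Mul t u)
  then show ?case using group.ev_closed[OF assms(2,4,5)] by (simp add: extends_mult[OF assms(1)])
next
  case (Inv t)
  then show ?case using group.ev_closed[OF assms(2,4,5)] by (simp add: extends_inv[OF assms(1-3)])
qed simp_all

lemma (in group) auto_one: "\<sigma> \<in> auto G \<Longrightarrow> \<sigma> \<one> = \<one>"
  using auto_mult[of \<sigma> G \<one> \<one>] auto_closed[of \<sigma> G \<one>] by (simp add: l_cancel_one')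

lemma (in group) auto_inv: "\<sigma> \<in> auto G \<Longrightarrow> x \<in> carrier G \<Longrightarrow> \<sigma> (inv x) = inv (\<sigma> x)"
  using auto_mult[of \<sigma> G "inv x" x] auto_one[of \<sigma>] auto_closed[of \<sigma> G]
  by (metis inv_closed inv_equality l_inv)

lemma (in group) auto_inj: "\<sigma> \<in> auto G \<Longrightarrow> x \<in> carrier G \<Longrightarrow> y \<in> carrier G \<Longrightarrow> \<sigma> x = \<sigma> y \<Longrightarrow> x = y"
  by (auto simp: auto_def Bij_def bij_betw_def inj_on_def)

lemma (in group) auto_eq_one_iff: "\<sigma> \<in> auto G \<Longrightarrow> x \<in> carrier G \<Longrightarrow> \<sigma> x = \<one> \<longleftrightarrow> x = \<one>"
  using auto_inj[of \<sigma> x \<one>] auto_one[of \<sigma>] by auto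

lemma (in group) auto_ev:
  assumes "\<sigma> \<in> auto G" "\<And>c. b c \<in> carrier G" "\<And>i. s i \<in> carrier G"
  shows "\<sigma> (ev G b s t) = ev G (\<lambda>c. \<sigma> (b c)) (\<lambda>i. \<sigma> (s i)) t"
  by (induction t) (simp_all add: auto_mult[OF assms(1)] auto_inv[OF assms(1)] ev_closed[OF assms(2,3)])

lemma (in group) mult_inv_eq_one: "x \<in> carrier G \<Longrightarrow> y \<in> carrier G \<Longrightarrow> x \<otimes> inv y = \<one> \<longleftrightarrow> x = y"
  by (metis inv_closed inv_equality inv_inv r_inv)

section \<open>Types, and groups in which they determine the elements\<close>

definition same_type ::
  "('a, 'b) monoid_scheme \<Rightarrow> (nat \<Rightarrow> 'a) \<Rightarrow> (nat \<Rightarrow> 'a) \<Rightarrow> (nat \<Rightarrow> 'a) \<Rightarrow> (nat \<Rightarrow> 'a) \<Rightarrow> bool" where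
  "same_type H b s b' s' \<longleftrightarrow> (\<forall>t. ev H b s t = \<one>\<^bsub>H\<^esub> \<longleftrightarrow> ev H b' s' t = \<one>\<^bsub>H\<^esub>)"

lemma same_type_sym: "same_type H b s b' s' \<Longrightarrow> same_type H b' s' b s"
  by (simp add: same_type_def)

lemma same_type_trans: "same_type H b s b' s' \<Longrightarrow> same_type H b' s' b'' s'' \<Longrightarrow> same_type H b s b'' s''"
  by (simp add: same_type_def)

lemma same_type_sub:
  assumes "same_type H b s b' s'"
  shows "same_type H (\<lambda>c. ev H b s (f c)) (\<lambda>i. ev H b s (g i)) (\<lambda>c. ev H b' s' (f c)) (\<lambda>i. ev H b' s' (g i))"
  using assms unfolding same_type_def ev_sub[symmetric] by blast

lemma same_type_proj:
  "same_type H b s b' s' \<Longrightarrow> same_type H b (\<lambda>_. s i) b' (\<lambda>_. s' i)"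
  using same_type_sub[of H b s b' s' Cst "\<lambda>_. Var i"] by simp

definition tp :: "('a, 'b) monoid_scheme \<Rightarrow> (nat \<Rightarrow> 'a) \<Rightarrow> (nat \<Rightarrow> 'a) \<Rightarrow> nat set" where
  "tp H b s = {n. ev H b s (decode n) = \<one>\<^bsub>H\<^esub>}"

lemma mem_tp: "code t \<in> tp H b s \<longleftrightarrow> ev H b s t = \<one>\<^bsub>H\<^esub>"
  by (simp add: tp_def)

lemma all_decode: "(\<forall>n. P (decode n)) \<longleftrightarrow> (\<forall>t. P t)"
  by (metis decode_code)

lemma tp_eq_iff: "tp H b s = tp H b' s' \<longleftrightarrow> same_type H b s b' s'"
  unfolding tp_def same_type_def set_eq_iff mem_Collect_eq by (rule all_decode)

text \<open>Finite sequences are padded with the identity, so that no length has to be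
  recorded.\<close>

definition finite_types :: "('a, 'b) monoid_scheme \<Rightarrow> (nat \<Rightarrow> 'a) \<Rightarrow> nat set set" where
  "finite_types H b = {tp H b s | s. (\<forall>i. s i \<in> carrier H) \<and> (\<exists>n. \<forall>i\<ge>n. s i = \<one>\<^bsub>H\<^esub>)}"

text \<open>\<open>Mul (Var 0) (Inv (Var 0))\<close> denotes the identity under every assignment in
  a group, without relying on a letter that names it.\<close>

definition cut_code :: "nat \<Rightarrow> nat \<Rightarrow> nat" where
  "cut_code n t = code (sub Cst (\<lambda>i. if i < n then Var i else Mul (Var 0) (Inv (Var 0))) (decode t))"

text \<open>This recovers the types of all \<open>\<omega>\<close>-sequences from those of the finite ones: only the
  latter behave well at limit stages of the tower.\<close>

definition seq_types :: "(nat + nat set) set \<Rightarrow> nat set \<Rightarrow> bool" where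
  "seq_types X r \<longleftrightarrow> (\<forall>n. \<exists>B. (\<forall>t. t \<in> B \<longleftrightarrow> cut_code n t \<in> r) \<and> Inr B \<in> X)"

text \<open>\<open>type_eq\<close> is the invariant carried up the tower. It is required for single
  elements only; \<open>seq_eq\<close> lifts it to sequences.\<close>

locale determined = group H for H :: "('a, 'b) monoid_scheme" (structure) +
  fixes b :: "nat \<Rightarrow> 'a"
  assumes b_closed [simp]: "b c \<in> carrier H"
    and type_eq: "x \<in> carrier H \<Longrightarrow> y \<in> carrier H \<Longrightarrow> same_type H b (\<lambda>_. x) b (\<lambda>_. y) \<Longrightarrow> x = y"
begin

lemma seq_eq:
  assumes "\<And>i. s i \<in> carrier H" "\<And>i. s' i \<in> carrier H" "same_type H b s b s'"
  shows "s = s'"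
  by (rule ext, rule type_eq[OF assms(1,2)], rule same_type_proj[OF assms(3)])

lemma ev_b_closed: "(\<And>i. s i \<in> carrier H) \<Longrightarrow> ev H b s t \<in> carrier H"
  by (rule ev_closed) auto

lemma auto_eq_id:
  assumes "\<sigma> \<in> auto H" "\<And>c. \<sigma> (b c) = b c" "x \<in> carrier H" shows "\<sigma> x = x"
proof (rule type_eq)
  show "\<sigma> x \<in> carrier H" using assms by (simp add: auto_closed)
  have "ev H b (\<lambda>_. \<sigma> x) t = \<sigma> (ev H b (\<lambda>_. x) t)" for t
    using auto_ev[of \<sigma> b "\<lambda>_. x" t] assms by simp
  moreover have "\<sigma> (ev H b (\<lambda>_. x) t) = \<one> \<longleftrightarrow> ev H b (\<lambda>_. x) t = \<one>" for t
    by (rule auto_eq_one_iff[OF assms(1) ev_b_closed[OF assms(3)]])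
  ultimately show "same_type H b (\<lambda>_. \<sigma> x) b (\<lambda>_. x)" by (simp only: same_type_def simp_thms)
qed (rule assms)

lemma auto_same_type:
  assumes "\<sigma> \<in> auto H" "\<And>i. x i \<in> carrier H"
  shows "same_type H b x (\<lambda>c. \<sigma> (b c)) (\<lambda>i. \<sigma> (x i))"
  unfolding same_type_def auto_ev[OF assms(1) b_closed assms(2), symmetric]
    auto_eq_one_iff[OF assms(1) ev_b_closed[OF assms(2)]] by simp

text \<open>Recovers the graph of an automorphism from its values on the base. For the converse,
  \<open>y\<close> is the image of some \<open>x'\<close>, and \<open>x'\<close> has the type of
  \<open>x\<close> over \<open>b\<close>, so \<open>type_eq\<close> identifies them.\<close>

lemma same_type_auto_iff:
  assumes "\<sigma> \<in> auto H" "x \<in> carrier H" "y \<in> carrier H"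
  shows "same_type H b (\<lambda>_. x) (\<lambda>c. \<sigma> (b c)) (\<lambda>_. y) \<longleftrightarrow> y = \<sigma> x"
proof
  assume st: "same_type H b (\<lambda>_. x) (\<lambda>c. \<sigma> (b c)) (\<lambda>_. y)"
  have "\<sigma> ` carrier H = carrier H" using assms(1) by (auto simp: auto_def Bij_def bij_betw_def)
  then obtain x' where x': "x' \<in> carrier H" "y = \<sigma> x'" using assms(3) by blast
  have "same_type H b (\<lambda>_. x') (\<lambda>c. \<sigma> (b c)) (\<lambda>_. y)"
    using auto_same_type[OF assms(1), of "\<lambda>_. x'"] x' by simp
  then have "same_type H b (\<lambda>_. x) b (\<lambda>_. x')" using st same_type_sym same_type_trans by blast
  then show "y = \<sigma> x" using type_eq x' assms(2) by blast
next
  assume "y = \<sigma> x"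
  then show "same_type H b (\<lambda>_. x) (\<lambda>c. \<sigma> (b c)) (\<lambda>_. y)"
    using auto_same_type[OF assms(1), of "\<lambda>_. x"] assms(2) by simp
qed

text \<open>Moving whole sequences lets several elements be moved at once: a pair shows that the
  relation is single-valued, and the triple of two elements and their product shows that it is
  multiplicative.\<close>

lemma auto_of_back_and_forth:
  assumes \<zeta>: "\<And>c. \<zeta> c \<in> carrier H"
    and fwd: "\<And>x. (\<And>i. x i \<in> carrier H) \<Longrightarrow> \<exists>y. (\<forall>i. y i \<in> carrier H) \<and> same_type H b x \<zeta> y"
    and bwd: "\<And>y. (\<And>i. y i \<in> carrier H) \<Longrightarrow> \<exists>x. (\<forall>i. x i \<in> carrier H) \<and> same_type H b x \<zeta> y"
  shows "\<exists>\<sigma>\<in>auto H. \<forall>c. \<sigma> (b c) = \<zeta> c"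
proof -
  define R where "R x y \<longleftrightarrow> same_type H b (\<lambda>_. x) \<zeta> (\<lambda>_. y)" for x y
  have R_inj: "x = x'" if "R x y" "R x' y" "x \<in> carrier H" "x' \<in> carrier H" for x x' y
    using type_eq[OF that(3,4)] same_type_trans[OF that(1)[unfolded R_def] same_type_sym[OF that(2)[unfolded R_def]]]
    by blast
  have R_fun: "y = y'" if y: "R x y" "R x y'" "x \<in> carrier H" "y \<in> carrier H" "y' \<in> carrier H" for x y y'
  proof -
    \<comment> \<open>Types over \<open>\<zeta>\<close> are not yet known to determine elements. So
      \<open>y\<close> and \<open>y'\<close> are pulled back together; over \<open>b\<close> both
      preimages must be \<open>x\<close>, and the equation between them is carried forward
      again.\<close>
    obtain s where s: "\<forall>i. s i \<in> carrier H" "same_type H b s \<zeta> (case_nat y (\<lambda>_. y'))"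
      using bwd[of "case_nat y (\<lambda>_. y')"] y by (fastforce split: nat.split)
    have "R (s 0) y" "R (s 1) y'"
      using same_type_proj[OF s(2), of 0] same_type_proj[OF s(2), of 1] by (simp_all add: R_def)
    then have "s 0 = x" "s 1 = x" using R_inj[of "s 0" y x] R_inj[of "s 1" y' x] s(1) y by blast+
    then have "ev H b s (Mul (Var 0) (Inv (Var 1))) = \<one>" using y(3) by simp
    then have "ev H \<zeta> (case_nat y (\<lambda>_. y')) (Mul (Var 0) (Inv (Var 1))) = \<one>"
      using s(2) unfolding same_type_def by blast
    then show ?thesis using y by (simp add: mult_inv_eq_one)
  qed
  have ex: "\<exists>y. y \<in> carrier H \<and> R x y" if x: "x \<in> carrier H" for x
  proof -
    obtain y where "\<forall>i. y i \<in> carrier H" "same_type H b (\<lambda>_. x) \<zeta> y" using fwd[of "\<lambda>_. x", OF x] by blast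
    then show ?thesis using same_type_proj[of H b "\<lambda>_. x" \<zeta> y 0] unfolding R_def by blast
  qed
  have surj: "\<exists>x. x \<in> carrier H \<and> R x y" if y: "y \<in> carrier H" for y
  proof -
    obtain x where "\<forall>i. x i \<in> carrier H" "same_type H b x \<zeta> (\<lambda>_. y)" using bwd[of "\<lambda>_. y", OF y] by blast
    then show ?thesis using same_type_proj[of H b x \<zeta> "\<lambda>_. y" 0] unfolding R_def by blast
  qed
  define \<sigma> where "\<sigma> = (\<lambda>x\<in>carrier H. SOME y. y \<in> carrier H \<and> R x y)"
  have s: "\<sigma> x \<in> carrier H" "R x (\<sigma> x)" if "x \<in> carrier H" for x
    using someI_ex[OF ex[OF that]] that by (simp_all add: \<sigma>_def)
  have \<sigma>: "\<sigma> x = y" if "x \<in> carrier H" "y \<in> carrier H" "R x y" for x y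
    using R_fun[of x] s that by blast
  have "\<sigma> (x \<otimes> x') = \<sigma> x \<otimes> \<sigma> x'" if x: "x \<in> carrier H" "x' \<in> carrier H" for x x'
  proof -
    let ?s = "case_nat x (case_nat x' (\<lambda>_. x \<otimes> x'))"
    let ?t = "Mul (Mul (Var 0) (Var 1)) (Inv (Var 2))"
    obtain s' where s': "\<forall>i. s' i \<in> carrier H" "same_type H b ?s \<zeta> s'"
      using fwd[of ?s] x by (fastforce split: nat.split)
    have R: "R x (s' 0)" "R x' (s' 1)" "R (x \<otimes> x') (s' 2)"
      using same_type_proj[OF s'(2), of 0] same_type_proj[OF s'(2), of 1] same_type_proj[OF s'(2), of 2]
      by (simp_all add: R_def numeral_2_eq_2)
    have "ev H b ?s ?t = \<one>" using x by (simp add: numeral_2_eq_2)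
    then have "ev H \<zeta> s' ?t = \<one>" using s'(2) unfolding same_type_def by blast
    then have "s' 0 \<otimes> s' 1 = s' 2" using s'(1) by (simp add: mult_inv_eq_one)
    moreover have "\<sigma> x = s' 0" "\<sigma> x' = s' 1" "\<sigma> (x \<otimes> x') = s' 2"
      using \<sigma> R x s'(1) by blast+
    ultimately show ?thesis by (simp only:)
  qed
  moreover have "inj_on \<sigma> (carrier H)" using R_inj s by (metis inj_onI)
  moreover have "\<sigma> ` carrier H = carrier H"
  proof (intro equalityI subsetI)
    fix y assume "y \<in> carrier H"
    then obtain x where "x \<in> carrier H" "R x y" using surj by blast
    then show "y \<in> \<sigma> ` carrier H" using \<sigma> \<open>y \<in> carrier H\<close> by blast
  qed (use s in auto)
  ultimately have "\<sigma> \<in> auto H"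
    using s(1) by (simp add: auto_def hom_def Bij_def bij_betw_def) (simp add: \<sigma>_def)
  moreover have "\<sigma> (b c) = \<zeta> c" for c
  proof -
    \<comment> \<open>Any two sequences of the same type serve here: substituting the letter
      \<open>c\<close> for the variable relates \<open>b c\<close> to
      \<open>\<zeta> c\<close>.\<close>
    obtain y where "\<forall>i. y i \<in> carrier H" "same_type H b (\<lambda>_. \<one>) \<zeta> y" using fwd[of "\<lambda>_. \<one>"] by auto
    then have "R (b c) (\<zeta> c)"
      using same_type_sub[of H b "\<lambda>_. \<one>" \<zeta> y Cst "\<lambda>_. Cst c"] by (simp add: R_def)
    then show ?thesis using \<sigma> \<zeta> by simp
  qed
  ultimately show ?thesis by blast
qed

lemma cut_code_tp:
  assumes "\<And>i. s i \<in> carrier H"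
  shows "cut_code n t \<in> tp H b s \<longleftrightarrow> t \<in> tp H b (\<lambda>i. if i < n then s i else \<one>)"
proof -
  have "ev H b s (if i < n then Var i else Mul (Var 0) (Inv (Var 0))) = (if i < n then s i else \<one>)" for i
    using assms by simp
  then show ?thesis by (simp add: cut_code_def mem_tp ev_sub) (simp add: tp_def)
qed

lemma sub_cut: "\<exists>n. \<forall>m\<ge>n. sub Cst (\<lambda>i. if i < m then Var i else u) t = t"
proof (induction t)
  case (Var i)
  show ?case by (rule exI[of _ "Suc i"]) simp
next
  case (Mul t t')
  then obtain m n where
    "\<forall>k\<ge>m. sub Cst (\<lambda>i. if i < k then Var i else u) t = t"
    "\<forall>k\<ge>n. sub Cst (\<lambda>i. if i < k then Var i else u) t' = t'" by blast
  then show ?case by (intro exI[of _ "max m n"]) simp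
qed auto

text \<open>Each cut of \<open>r\<close> is realized by some sequence \<open>s n\<close>. By
  \<open>type_eq\<close> these agree where neither has been cut, so a diagonal sequence realizes all
  of \<open>r\<close>, every term having only finitely many variables.\<close>

lemma seq_types_iff:
  "seq_types (Inr ` finite_types H b) r \<longleftrightarrow> (\<exists>s. (\<forall>i. s i \<in> carrier H) \<and> r = tp H b s)"
proof
  assume "\<exists>s. (\<forall>i. s i \<in> carrier H) \<and> r = tp H b s"
  then obtain s where s: "\<And>i. s i \<in> carrier H" "r = tp H b s" by blast
  have "tp H b (\<lambda>i. if i < n then s i else \<one>) \<in> finite_types H b" for n
    unfolding finite_types_def using s(1)
    by (intro CollectI exI[of _ "\<lambda>i. if i < n then s i else \<one>"]) (auto intro!: exI[of _ n])
  then show "seq_types (Inr ` finite_types H b) r"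
    unfolding seq_types_def s(2) cut_code_tp[OF s(1)] by blast
next
  assume r: "seq_types (Inr ` finite_types H b) r"
  have "\<exists>s. (\<forall>i. s i \<in> carrier H) \<and> (\<forall>t. t \<in> tp H b s \<longleftrightarrow> cut_code n t \<in> r)" for n
    using r unfolding seq_types_def finite_types_def by blast
  then obtain s where s: "\<And>n i. s n i \<in> carrier H" "\<And>n t. t \<in> tp H b (s n) \<longleftrightarrow> cut_code n t \<in> r"
    by metis
  \<comment> \<open>A term in \<open>Var i\<close> alone is unchanged by a cut at any
    \<open>n > i\<close>, so the type of \<open>s n i\<close> can be read off \<open>r\<close> and
    does not depend on \<open>n\<close>.\<close>
  have agree: "s n i = s m i" if "i < n" "i < m" for i m n
  proof (rule type_eq[OF s(1) s(1)])
    have eq: "cut_code n (code (sub Cst (\<lambda>_. Var i) t)) = code (sub Cst (\<lambda>_. Var i) t)" if "i < n" for t n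
    proof -
      have "sub Cst (\<lambda>i. if i < n then Var i else u) (sub Cst (\<lambda>_. Var i) t) = sub Cst (\<lambda>_. Var i) t" for u
        using that by (induction t) simp_all
      then show ?thesis by (simp add: cut_code_def)
    qed
    have "ev H b (\<lambda>_. s n i) t = \<one> \<longleftrightarrow> code (sub Cst (\<lambda>_. Var i) t) \<in> r" if "i < n" for t n
      using s(2)[of "code (sub Cst (\<lambda>_. Var i) t)" n] by (simp add: eq[OF that] mem_tp ev_sub)
    then show "same_type H b (\<lambda>_. s n i) b (\<lambda>_. s m i)" using that by (simp add: same_type_def)
  qed
  \<comment> \<open>Position \<open>i\<close> survives a cut at \<open>n\<close> only if
    \<open>i < n\<close>, so \<open>Suc i\<close> is the first usable index.\<close>
  define s' where "s' i = s (Suc i) i" for i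
  have s'_closed: "\<forall>i. s' i \<in> carrier H" using s(1) by (simp add: s'_def)
  have "code t \<in> tp H b s' \<longleftrightarrow> code t \<in> r" for t
  proof -
    obtain n where n: "sub Cst (\<lambda>i. if i < n then Var i else Mul (Var 0) (Inv (Var 0))) t = t"
      using sub_cut by blast
    then have 1: "cut_code n (code t) = code t" by (simp add: cut_code_def)
    have 2: "code t \<in> tp H b (\<lambda>i. if i < n then s i else \<one>) \<longleftrightarrow> code t \<in> tp H b s"
      if "\<And>i. s i \<in> carrier H" for s using cut_code_tp[where s = s and n = n and t = "code t", OF that] 1 by simp
    have "(\<lambda>i. if i < n then s' i else \<one>) = (\<lambda>i. if i < n then s n i else \<one>)"
    proof
      fix i
      have "s' i = s n i" if "i < n" unfolding s'_def by (rule agree) (use that in auto)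
      then show "(if i < n then s' i else \<one>) = (if i < n then s n i else \<one>)" by simp
    qed
    then have "code t \<in> tp H b s' \<longleftrightarrow> code t \<in> tp H b (s n)"
      using 2[of s'] 2[of "s n"] s(1) by (simp add: s'_def)
    then show ?thesis using s(2) 1 by simp
  qed
  then have "code (decode n) \<in> tp H b s' \<longleftrightarrow> code (decode n) \<in> r" for n .
  then have "r = tp H b s'" by auto
  then show "\<exists>s. (\<forall>i. s i \<in> carrier H) \<and> r = tp H b s" using s'_closed by blast
qed

end

section \<open>One step of the tower\<close>

text \<open>A pair of sequences is represented by its interleaving. The odd members list the images of the
  base under the automorphisms \<open>t\<close>, and \<open>p\<close> is a type over the base, whereas the even members of
  \<open>q\<close> are considered over the image of the base under \<open>t\<close>.\<close>

definition odd_code :: "nat \<Rightarrow> nat" where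
  "odd_code n = code (sub Cst (\<lambda>i. Var (Suc (2 * i))) (decode n))"

definition odd_part :: "nat set \<Rightarrow> nat set \<Rightarrow> bool" where
  "odd_part q r \<longleftrightarrow> (\<forall>n. n \<in> r \<longleftrightarrow> odd_code n \<in> q)"

definition even_code :: "nat \<Rightarrow> nat \<Rightarrow> nat" where
  "even_code t n = code (sub (\<lambda>c. Var (Suc (2 * prod_encode (t, c)))) (\<lambda>i. Var (2 * i)) (decode n))"

definition even_part :: "nat \<Rightarrow> nat set \<Rightarrow> nat set \<Rightarrow> bool" where
  "even_part t p q \<longleftrightarrow> (\<forall>n. n \<in> p \<longleftrightarrow> even_code t n \<in> q)"

text \<open>The two conditions of \<open>auto_of_back_and_forth\<close>, forward and then backward.
  A type can be shared with \<open>r\<close> only as part of a joint type \<open>q\<close>;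
  \<open>odd_part q r\<close> forces the odd entries to be the very elements that \<open>r\<close>
  describes.\<close>

definition acts :: "(nat + nat set) set \<Rightarrow> nat set \<Rightarrow> nat \<Rightarrow> bool" where
  "acts X r t \<longleftrightarrow>
    (\<forall>p. seq_types X p \<longrightarrow> (\<exists>q. seq_types X q \<and> odd_part q r \<and> even_part t p q)) \<and>
    (\<forall>q. seq_types X q \<and> odd_part q r \<longrightarrow> (\<exists>p. seq_types X p \<and> even_part t p q))"

definition source_code :: "nat \<Rightarrow> nat \<Rightarrow> nat" where
  "source_code i n = code (sub Cst (\<lambda>_. Var i) (decode n))"

definition target_code :: "nat \<Rightarrow> nat \<Rightarrow> nat \<Rightarrow> nat" where
  "target_code t j n = code (sub (\<lambda>c. Var (prod_encode (t, c))) (\<lambda>_. Var j) (decode n))"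

text \<open>The criterion of \<open>same_type_auto_iff\<close>: entry \<open>i\<close> over the base
  against entry \<open>j\<close> over the image of the base in row \<open>t\<close>.\<close>

definition maps :: "nat set \<Rightarrow> nat \<Rightarrow> nat \<Rightarrow> nat \<Rightarrow> bool" where
  "maps r t i j \<longleftrightarrow> (\<forall>n. source_code i n \<in> r \<longleftrightarrow> target_code t j n \<in> r)"

definition mul_index :: "nat \<Rightarrow> nat \<Rightarrow> nat \<Rightarrow> nat" where
  "mul_index m n g = prod_encode (code (Mul (decode m) (decode n)), g)"

definition inv_index :: "nat \<Rightarrow> nat \<Rightarrow> nat" where
  "inv_index n g = prod_encode (code (Inv (decode n)), g)"

definition cst_index :: "nat \<Rightarrow> nat \<Rightarrow> nat" where
  "cst_index c g = prod_encode (code (Cst c), g)"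

text \<open>Row \<open>Cst c\<close> of the table must be conjugation by the base element
  \<open>c\<close>; this ties letters to the inner automorphisms with which the tower identifies
  them.\<close>

definition conj_code :: "nat \<Rightarrow> nat \<Rightarrow> nat" where
  "conj_code c g = code (Mul (Mul (Mul (Cst c) (Cst g)) (Inv (Cst c))) (Inv (Var (cst_index c g))))"

definition fix_code :: "nat \<Rightarrow> nat \<Rightarrow> nat" where
  "fix_code t g = code (Mul (Var (prod_encode (t, g))) (Inv (Cst g)))"

text \<open>Expresses that all variables from position \<open>n\<close> on act trivially, that is,
  that the coded sequence is finite. The form \<open>n + k\<close> replaces an order
  relation.\<close>

definition tail_code :: "nat \<Rightarrow> nat \<Rightarrow> nat \<Rightarrow> nat" where
  "tail_code n k g = fix_code (code (Var (n + k))) g"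

text \<open>Let \<open>X\<close> represent \<open>H\<close>. If \<open>A\<close> is the type of a sequence in the automorphism group of
  \<open>H\<close>, then \<open>r\<close> is the type of the elements of \<open>H\<close>, indexed by pairs \<open>(t, g)\<close>, that arise by
  applying to the base element \<open>g\<close> the automorphism that is the value of the term \<open>t\<close>.\<close>

definition succ_formula :: "nat \<Rightarrow> (nat + nat set) set \<Rightarrow> nat set \<Rightarrow> bool" where
  "succ_formula e X A \<longleftrightarrow> (\<exists>r. seq_types X r \<and>
    (\<forall>t. acts X r t) \<and>
    (\<forall>m n g. maps r m (prod_encode (n, g)) (mul_index m n g)) \<and>
    (\<forall>n g. maps r n (inv_index n g) (cst_index e g)) \<and>
    (\<forall>c g. conj_code c g \<in> r) \<and>
    (\<exists>n. \<forall>k g. tail_code n k g \<in> r) \<and>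
    (\<forall>t. t \<in> A \<longleftrightarrow> (\<forall>g. fix_code t g \<in> r)))"

section \<open>Meaning of the coded conditions\<close>

context determined
begin

abbreviation "rep \<equiv> Inr ` finite_types H b"

lemma odd_part_tp:
  assumes "\<And>i. w i \<in> carrier H" "\<And>i. z i \<in> carrier H"
  shows "odd_part (tp H b w) (tp H b z) \<longleftrightarrow> z = (\<lambda>i. w (Suc (2 * i)))"
proof -
  have "odd_part (tp H b w) (tp H b z) \<longleftrightarrow> same_type H b z b (\<lambda>i. w (Suc (2 * i)))"
    unfolding odd_part_def odd_code_def mem_tp ev_sub
    by (simp add: tp_def same_type_def all_decode[of "\<lambda>t. ev H b z t = \<one> \<longleftrightarrow> ev H b (\<lambda>i. w (Suc (2 * i))) t = \<one>"])
  also have "\<dots> \<longleftrightarrow> z = (\<lambda>i. w (Suc (2 * i)))"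
    using seq_eq[of z "\<lambda>i. w (Suc (2 * i))"] assms by (auto simp: same_type_def)
  finally show ?thesis .
qed

lemma even_part_tp:
  "even_part t (tp H b x) (tp H b w) \<longleftrightarrow>
    same_type H b x (\<lambda>c. w (Suc (2 * prod_encode (t, c)))) (\<lambda>i. w (2 * i))"
  unfolding even_part_def even_code_def mem_tp ev_sub
  by (simp add: tp_def same_type_def all_decode[of "\<lambda>u. ev H b x u = \<one> \<longleftrightarrow>
      ev H (\<lambda>c. w (Suc (2 * prod_encode (t, c)))) (\<lambda>i. w (2 * i)) u = \<one>"])

text \<open>By \<open>odd_part_tp\<close> the odd entries of every admissible \<open>q\<close> are
  \<open>z\<close> itself, so the even entries are compared over the intended images, and
  \<open>auto_of_back_and_forth\<close> applies.\<close>

lemma acts_tp: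
  assumes z: "\<And>i. z i \<in> carrier H"
  shows "acts rep (tp H b z) t \<longleftrightarrow> (\<exists>\<sigma>\<in>auto H. \<forall>c. \<sigma> (b c) = z (prod_encode (t, c)))"
proof
  assume a: "acts rep (tp H b z) t"
  show "\<exists>\<sigma>\<in>auto H. \<forall>c. \<sigma> (b c) = z (prod_encode (t, c))"
  proof (rule auto_of_back_and_forth)
    fix x :: "nat \<Rightarrow> 'a" assume "\<And>i. x i \<in> carrier H"
    then have "seq_types rep (tp H b x)" using seq_types_iff by blast
    then obtain q where q: "seq_types rep q" "odd_part q (tp H b z)" "even_part t (tp H b x) q"
      using a unfolding acts_def by blast
    then obtain w where w: "\<And>i. w i \<in> carrier H" "q = tp H b w" using seq_types_iff by blast
    have "z = (\<lambda>i. w (Suc (2 * i)))" using odd_part_tp[where w = w and z = z, OF w(1) z] q(2) w(2) by blast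
    then have "same_type H b x (\<lambda>c. z (prod_encode (t, c))) (\<lambda>i. w (2 * i))"
      using q(3) unfolding w(2) even_part_tp by simp
    then show "\<exists>y. (\<forall>i. y i \<in> carrier H) \<and> same_type H b x (\<lambda>c. z (prod_encode (t, c))) y"
      using w(1) by (intro exI[of _ "\<lambda>i. w (2 * i)"]) simp
  next
    fix y :: "nat \<Rightarrow> 'a" assume y: "\<And>i. y i \<in> carrier H"
    \<comment> \<open>The backward clause accepts only types whose odd part is \<open>r\<close>, so
      \<open>y\<close> is offered interleaved with \<open>z\<close>.\<close>
    define w where "w i = (if even i then y (i div 2) else z (i div 2))" for i
    have w: "\<And>i. w i \<in> carrier H" using y z by (simp add: w_def)
    have "seq_types rep (tp H b w)" using w seq_types_iff by blast
    moreover have "odd_part (tp H b w) (tp H b z)" using odd_part_tp[where w = w and z = z, OF w z] by (simp add: w_def)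
    ultimately obtain p where p: "seq_types rep p" "even_part t p (tp H b w)"
      using a unfolding acts_def by blast
    then obtain x where x: "\<And>i. x i \<in> carrier H" "p = tp H b x" using seq_types_iff by blast
    have "same_type H b x (\<lambda>c. z (prod_encode (t, c))) y"
      using p(2) unfolding x(2) even_part_tp by (simp add: w_def)
    then show "\<exists>x. (\<forall>i. x i \<in> carrier H) \<and> same_type H b x (\<lambda>c. z (prod_encode (t, c))) y"
      using x(1) by (intro exI[of _ x]) simp
  qed (rule z)
next
  assume "\<exists>\<sigma>\<in>auto H. \<forall>c. \<sigma> (b c) = z (prod_encode (t, c))"
  then obtain \<sigma> where s: "\<sigma> \<in> auto H" "\<And>c. z (prod_encode (t, c)) = \<sigma> (b c)" by metis
  have surj: "\<sigma> ` carrier H = carrier H" using s(1) by (auto simp: auto_def Bij_def bij_betw_def)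
  show "acts rep (tp H b z) t"
    unfolding acts_def
  proof (intro conjI allI impI)
    fix p assume "seq_types rep p"
    then obtain x where x: "\<And>i. x i \<in> carrier H" "p = tp H b x" using seq_types_iff by blast
    define w where "w i = (if even i then \<sigma> (x (i div 2)) else z (i div 2))" for i
    have w: "\<And>i. w i \<in> carrier H" using x z s(1) by (simp add: w_def auto_closed)
    have "seq_types rep (tp H b w)" using w seq_types_iff by blast
    moreover have "odd_part (tp H b w) (tp H b z)" using odd_part_tp[where w = w and z = z, OF w z] by (simp add: w_def)
    moreover have "even_part t p (tp H b w)"
      unfolding x(2) even_part_tp using auto_same_type[where x = x, OF s(1) x(1)] by (simp add: w_def s(2))
    ultimately show "\<exists>q. seq_types rep q \<and> odd_part q (tp H b z) \<and> even_part t p q" by blast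
  next
    fix q assume q: "seq_types rep q \<and> odd_part q (tp H b z)"
    then obtain w where w: "\<And>i. w i \<in> carrier H" "q = tp H b w" using seq_types_iff by blast
    have zw: "z = (\<lambda>i. w (Suc (2 * i)))" using odd_part_tp[where w = w and z = z, OF w(1) z] q w(2) by blast
    have "\<forall>i. \<exists>x. x \<in> carrier H \<and> \<sigma> x = w (2 * i)" using surj w(1) by (metis imageE)
    then obtain x where x: "\<And>i. x i \<in> carrier H" "\<And>i. \<sigma> (x i) = w (2 * i)" by metis
    have "even_part t (tp H b x) q"
      unfolding w(2) even_part_tp using auto_same_type[where x = x, OF s(1) x(1)] by (simp add: x(2) s(2)[unfolded zw])
    moreover have "seq_types rep (tp H b x)" using x(1) seq_types_iff by blast
    ultimately show "\<exists>p. seq_types rep p \<and> even_part t p q" by blast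
  qed
qed

lemma maps_tp:
  assumes z: "\<And>i. z i \<in> carrier H" and s: "\<sigma> \<in> auto H" "\<And>c. \<sigma> (b c) = z (prod_encode (t, c))"
  shows "maps (tp H b z) t i j \<longleftrightarrow> z j = \<sigma> (z i)"
proof -
  have "maps (tp H b z) t i j \<longleftrightarrow> same_type H b (\<lambda>_. z i) (\<lambda>c. \<sigma> (b c)) (\<lambda>_. z j)"
    unfolding maps_def source_code_def target_code_def mem_tp ev_sub s(2)
    by (simp add: same_type_def all_decode[of "\<lambda>u. ev H b (\<lambda>_. z i) u = \<one> \<longleftrightarrow>
      ev H (\<lambda>c. z (prod_encode (t, c))) (\<lambda>_. z j) u = \<one>"])
  then show ?thesis using same_type_auto_iff[OF s(1) z z] by simp
qed

lemma conj_code_tp: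
  assumes "\<And>i. z i \<in> carrier H"
  shows "conj_code c g \<in> tp H b z \<longleftrightarrow> z (cst_index c g) = b c \<otimes> b g \<otimes> inv (b c)"
  using mult_inv_eq_one[of "b c \<otimes> b g \<otimes> inv (b c)" "z (cst_index c g)"] assms
  by (auto simp: conj_code_def mem_tp)

lemma fix_code_tp:
  assumes "\<And>i. z i \<in> carrier H"
  shows "fix_code t g \<in> tp H b z \<longleftrightarrow> z (prod_encode (t, g)) = b g"
  using mult_inv_eq_one[of "z (prod_encode (t, g))" "b g"] assms by (simp add: fix_code_def mem_tp)

end

text \<open>The letter \<open>e\<close> for the identity is what allows \<open>succ_formula\<close>
  to state the inverse law.\<close>

locale tower_step = determined H b + K: group K
  for H :: "('a, 'b) monoid_scheme" (structure) and b and K :: "('a, 'c) monoid_scheme" +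
  fixes f :: "'a \<Rightarrow> 'a \<Rightarrow> 'a" and e :: nat
  assumes ext: "extends H K" and f_iso: "f \<in> iso K (AutoGroup H)"
    and f_inner: "g \<in> carrier H \<Longrightarrow> f g = inner_aut H g" and b_e: "b e = \<one>"
begin

lemma f_auto: "k \<in> carrier K \<Longrightarrow> f k \<in> auto H"
  using f_iso by (auto simp: iso_def bij_betw_def)

lemma f_closed: "k \<in> carrier K \<Longrightarrow> x \<in> carrier H \<Longrightarrow> f k x \<in> carrier H"
  using f_auto by (simp add: auto_closed)

lemma f_mult: "k \<in> carrier K \<Longrightarrow> l \<in> carrier K \<Longrightarrow> f (k \<otimes>\<^bsub>K\<^esub> l) = f k \<otimes>\<^bsub>AutoGroup H\<^esub> f l"
  using f_iso by (simp add: iso_def hom_def)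

lemma f_mult_apply:
  "k \<in> carrier K \<Longrightarrow> l \<in> carrier K \<Longrightarrow> x \<in> carrier H \<Longrightarrow> f (k \<otimes>\<^bsub>K\<^esub> l) x = f k (f l x)"
  by (simp add: f_mult AutoGroup_mult f_auto)

lemma f_inject: "k \<in> carrier K \<Longrightarrow> l \<in> carrier K \<Longrightarrow> f k = f l \<Longrightarrow> k = l"
  using f_iso by (auto simp: iso_def bij_betw_def inj_on_def)

lemma f_surj: assumes "\<sigma> \<in> auto H" shows "\<exists>k\<in>carrier K. f k = \<sigma>"
proof -
  have "\<sigma> \<in> f ` carrier K" using f_iso assms by (simp add: iso_def bij_betw_def)
  then show ?thesis by blast
qed

lemma H_sub_K: "x \<in> carrier H \<Longrightarrow> x \<in> carrier K"
  by (rule extends_carrier[OF ext])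

lemma b_K [simp]: "b c \<in> carrier K"
  by (rule H_sub_K) simp

lemma one_K: "\<one>\<^bsub>K\<^esub> = \<one>"
  by (rule extends_one[OF ext group_axioms K.group_axioms])

lemma ev_K: "(\<And>i. s i \<in> carrier H) \<Longrightarrow> ev K b s t = ev H b s t"
  by (rule ev_extends[OF ext group_axioms K.group_axioms]) auto

lemma f_one: "x \<in> carrier H \<Longrightarrow> f \<one>\<^bsub>K\<^esub> x = x"
  by (simp add: one_K f_inner inner_aut_def)

text \<open>Both sides of \<open>k g = (f k g) k\<close> have the same image under \<open>f\<close>,
  by \<open>auto_inner\<close>. Thus applying an automorphism of \<open>H\<close> becomes a group
  term in \<open>K\<close>.\<close>

lemma conj_K:
  assumes "k \<in> carrier K" "g \<in> carrier H" shows "k \<otimes>\<^bsub>K\<^esub> g \<otimes>\<^bsub>K\<^esub> inv\<^bsub>K\<^esub> k = f k g"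
proof -
  have "k \<otimes>\<^bsub>K\<^esub> g = f k g \<otimes>\<^bsub>K\<^esub> k"
  proof (rule f_inject)
    show "f (k \<otimes>\<^bsub>K\<^esub> g) = f (f k g \<otimes>\<^bsub>K\<^esub> k)"
      using assms f_closed[OF assms] by (simp add: f_mult H_sub_K f_inner auto_inner f_auto)
  qed (use assms f_closed[OF assms] H_sub_K in auto)
  then show ?thesis using assms f_closed[OF assms] by (simp add: H_sub_K K.m_assoc)
qed

text \<open>The quotient of \<open>k\<close> by \<open>l\<close> acts trivially on the base, hence
  on all of \<open>H\<close> by \<open>auto_eq_id\<close>. So a row of images of the base determines
  an element of \<open>K\<close>.\<close>

lemma K_eqI:
  assumes k: "k \<in> carrier K" and l: "l \<in> carrier K" and eq: "\<And>c. f k (b c) = f l (b c)"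
  shows "k = l"
proof -
  have m: "inv\<^bsub>K\<^esub> l \<otimes>\<^bsub>K\<^esub> k \<in> carrier K" using k l by simp
  have "f (inv\<^bsub>K\<^esub> l \<otimes>\<^bsub>K\<^esub> k) (b c) = b c" for c
  proof -
    have "f (inv\<^bsub>K\<^esub> l \<otimes>\<^bsub>K\<^esub> k) (b c) = f (inv\<^bsub>K\<^esub> l) (f l (b c))" using k l by (simp add: f_mult_apply eq)
    also have "\<dots> = f (inv\<^bsub>K\<^esub> l \<otimes>\<^bsub>K\<^esub> l) (b c)" by (rule f_mult_apply[symmetric]) (use l in auto)
    finally show ?thesis using l by (simp add: f_one)
  qed
  then have "f (inv\<^bsub>K\<^esub> l \<otimes>\<^bsub>K\<^esub> k) x = x" if "x \<in> carrier H" for x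
    using auto_eq_id[OF f_auto[OF m]] that by blast
  then have "f (inv\<^bsub>K\<^esub> l \<otimes>\<^bsub>K\<^esub> k) = f \<one>\<^bsub>K\<^esub>"
    by (intro auto_eqI[OF f_auto[OF m] f_auto[OF K.one_closed]]) (simp add: f_one)
  then have "inv\<^bsub>K\<^esub> l \<otimes>\<^bsub>K\<^esub> k = \<one>\<^bsub>K\<^esub>" using f_inject m by blast
  then show ?thesis using K.inv_mult_one_eq l k by blast
qed

lemma determined_K: "determined K b"
proof
  fix x y assume x: "x \<in> carrier K" and y: "y \<in> carrier K"
    and st: "same_type K b (\<lambda>_. x) b (\<lambda>_. y)"
  show "x = y"
  proof (rule K_eqI[OF x y type_eq])
    fix c
    show xc: "f x (b c) \<in> carrier H" "f y (b c) \<in> carrier H" using x y by (simp_all add: f_closed)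
    have "same_type K b (\<lambda>_. f x (b c)) b (\<lambda>_. f y (b c))"
      using same_type_sub[OF st, of Cst "\<lambda>_. Mul (Mul (Var 0) (Cst c)) (Inv (Var 0))"] x y
      by (simp add: conj_K)
    then show "same_type H b (\<lambda>_. f x (b c)) b (\<lambda>_. f y (b c))"
      using xc by (simp add: same_type_def ev_K one_K)
  qed
qed simp

sublocale K: determined K b by (rule determined_K)

text \<open>The type of \<open>x\<close>, padded with identities, is realized in \<open>H\<close>.
  Types determine sequences in \<open>K\<close> as well, so the realization starts with
  \<open>x\<close>.\<close>

lemma finite_types_eq_imp:
  assumes "finite_types K b = finite_types H b" shows "carrier K = carrier H"
proof (intro equalityI subsetI)
  fix x assume x: "x \<in> carrier K"
  let ?s = "case_nat x (\<lambda>_. \<one>)"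
  have xs: "?s i \<in> carrier K" for i using x H_sub_K by (simp split: nat.split)
  have "?s i = \<one>" if "i \<ge> 1" for i using that by (cases i) auto
  then have "tp K b ?s \<in> finite_types K b"
    unfolding finite_types_def one_K using xs by blast
  then have "tp K b ?s \<in> finite_types H b" by (simp only: assms)
  then obtain s where s: "tp K b ?s = tp H b s" "\<And>i. s i \<in> carrier H"
    unfolding finite_types_def by blast
  have "tp H b s = tp K b s" using s(2) by (simp add: tp_def ev_K one_K)
  then have "same_type K b ?s b s" using s(1) by (simp flip: tp_eq_iff)
  then have "?s = s" using K.seq_eq[of ?s s] xs s(2) H_sub_K by blast
  then show "x \<in> carrier H" using s(2)[of 0] by (metis nat.case(1))
qed (rule H_sub_K)

text \<open>Row \<open>t\<close> of \<open>z\<close> yields an element \<open>k t\<close> of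
  \<open>K\<close>. The remaining clauses make \<open>k\<close> respect letters, products and
  inverses, so it is the evaluation of terms at its own values on the variables.\<close>

lemma succ_formula_sound:
  assumes "succ_formula e rep A" shows "A \<in> finite_types K b"
proof -
  obtain r where r: "seq_types rep r" "\<And>t. acts rep r t"
    "\<And>m n g. maps r m (prod_encode (n, g)) (mul_index m n g)"
    "\<And>n g. maps r n (inv_index n g) (cst_index e g)" "\<And>c g. conj_code c g \<in> r"
    "\<exists>n. \<forall>k g. tail_code n k g \<in> r" "\<And>t. t \<in> A \<longleftrightarrow> (\<forall>g. fix_code t g \<in> r)"
    using assms unfolding succ_formula_def by blast
  obtain z where z: "\<And>i. z i \<in> carrier H" "r = tp H b z" using r(1) seq_types_iff by blast
  have "\<exists>k. k \<in> carrier K \<and> (\<forall>c. f k (b c) = z (prod_encode (t, c)))" for t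
    using r(2)[of t] f_surj unfolding z(2) acts_tp[where z = z, OF z(1)] by metis
  then obtain k where k: "\<And>t. k t \<in> carrier K" "\<And>t c. f (k t) (b c) = z (prod_encode (t, c))"
    by metis
  note maps = maps_tp[where z = z, OF z(1) f_auto[OF k(1)] k(2)]
  have cst: "k (code (Cst c)) = b c" for c
  proof (rule K_eqI[OF k(1) b_K])
    show "f (k (code (Cst c))) (b g) = f (b c) (b g)" for g
      using r(5)[of c g] unfolding z(2) conj_code_tp[where z = z, OF z(1)]
      by (simp add: k(2) f_inner inner_aut_def cst_index_def)
  qed
  have mul: "k (code (Mul t u)) = k (code t) \<otimes>\<^bsub>K\<^esub> k (code u)" for t u
  proof (rule K_eqI)
    show "f (k (code (Mul t u))) (b g) = f (k (code t) \<otimes>\<^bsub>K\<^esub> k (code u)) (b g)" for g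
      using r(3)[of "code t" "code u" g] unfolding z(2) maps
      by (simp add: k mul_index_def f_mult_apply)
  qed (simp_all add: k)
  have inv: "k (code (Inv t)) = inv\<^bsub>K\<^esub> (k (code t))" for t
  proof -
    \<comment> \<open>The clause for inverses says that the composite of the two rows is the row of
      the letter for the identity.\<close>
    have "k (code t) \<otimes>\<^bsub>K\<^esub> k (code (Inv t)) = \<one>\<^bsub>K\<^esub>"
    proof (rule K_eqI)
      fix g
      have "f (k (code t)) (f (k (code (Inv t))) (b g)) = f (k (code (Cst e))) (b g)"
        using r(4)[of "code t" g] unfolding z(2) maps by (simp add: k inv_index_def cst_index_def)
      then show "f (k (code t) \<otimes>\<^bsub>K\<^esub> k (code (Inv t))) (b g) = f \<one>\<^bsub>K\<^esub> (b g)"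
        by (simp add: k f_mult_apply cst b_e one_K)
    qed (simp_all add: k)
    then show ?thesis using k(1) by (metis K.inv_equality K.inv_inv K.inv_closed)
  qed
  define s where "s i = k (code (Var i))" for i
  have ev: "ev K b s t = k (code t)" for t
    by (induction t) (simp_all add: s_def cst mul inv)
  have fixed: "(\<forall>g. fix_code t g \<in> r) \<longleftrightarrow> k t = \<one>\<^bsub>K\<^esub>" for t
  proof -
    have "(\<forall>g. fix_code t g \<in> r) \<longleftrightarrow> (\<forall>g. f (k t) (b g) = f \<one>\<^bsub>K\<^esub> (b g))"
      unfolding z(2) fix_code_tp[where z = z, OF z(1)] by (simp add: k f_one)
    also have "\<dots> \<longleftrightarrow> k t = \<one>\<^bsub>K\<^esub>" using K_eqI[OF k(1) K.one_closed] by auto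
    finally show ?thesis .
  qed
  have "t \<in> A \<longleftrightarrow> t \<in> tp K b s" for t
    by (simp add: r(7) fixed tp_def ev)
  then have "A = tp K b s" by blast
  moreover obtain n where "\<forall>k g. tail_code n k g \<in> r" using r(6) by blast
  then have "s (n + i) = \<one>\<^bsub>K\<^esub>" for i using fixed[of "code (Var (n + i))"] by (simp add: tail_code_def s_def)
  then have "\<forall>i\<ge>n. s i = \<one>\<^bsub>K\<^esub>" by (metis le_add_diff_inverse)
  ultimately show ?thesis unfolding finite_types_def using k(1)
    by (intro CollectI exI[of _ s] conjI allI) (auto simp: s_def)
qed

text \<open>The witness is the type over \<open>H\<close> of the full table: the values of all terms
  at \<open>s\<close>, applied as automorphisms to all letters.\<close>

lemma succ_formula_complete:
  assumes "A \<in> finite_types K b" shows "succ_formula e rep A"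
proof -
  obtain s n where s: "A = tp K b s" "\<And>i. s i \<in> carrier K" "\<And>i. i \<ge> n \<Longrightarrow> s i = \<one>\<^bsub>K\<^esub>"
    using assms unfolding finite_types_def by blast
  define v where "v t = ev K b s (decode t)" for t
  define z where "z i = (case prod_decode i of (t, g) \<Rightarrow> f (v t) (b g))" for i
  have v: "v t \<in> carrier K" for t unfolding v_def by (rule K.ev_closed) (simp_all add: s)
  have z_pair: "z (prod_encode (t, g)) = f (v t) (b g)" for t g by (simp add: z_def)
  have z: "z i \<in> carrier H" for i using v by (simp add: z_def f_closed split: prod.split)
  note maps = maps_tp[where z = z, OF z f_auto[OF v] z_pair[symmetric]]
  have fixed: "(\<forall>g. fix_code t g \<in> tp H b z) \<longleftrightarrow> v t = \<one>\<^bsub>K\<^esub>" for t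
  proof -
    have "(\<forall>g. fix_code t g \<in> tp H b z) \<longleftrightarrow> (\<forall>g. f (v t) (b g) = f \<one>\<^bsub>K\<^esub> (b g))"
      unfolding fix_code_tp[where z = z, OF z] by (simp add: z_pair f_one)
    also have "\<dots> \<longleftrightarrow> v t = \<one>\<^bsub>K\<^esub>" using K_eqI[OF v K.one_closed] by auto
    finally show ?thesis .
  qed
  show ?thesis
    unfolding succ_formula_def
  proof (intro exI[of _ "tp H b z"] conjI allI)
    show "seq_types rep (tp H b z)" using z seq_types_iff by blast
    show "acts rep (tp H b z) t" for t
      unfolding acts_tp[where z = z, OF z] using f_auto[OF v] z_pair by metis
    show "maps (tp H b z) m (prod_encode (n, g)) (mul_index m n g)" for m n g
      unfolding maps mul_index_def z_pair using f_mult_apply[OF v v] by (simp add: v_def)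
    show "maps (tp H b z) n (inv_index n g) (cst_index e g)" for n g
    proof -
      have "f (v n) (f (inv\<^bsub>K\<^esub> (v n)) (b g)) = f (v n \<otimes>\<^bsub>K\<^esub> inv\<^bsub>K\<^esub> (v n)) (b g)"
        by (rule f_mult_apply[symmetric]) (simp_all add: v)
      then show ?thesis
        unfolding maps inv_index_def cst_index_def z_pair using v by (simp add: v_def b_e one_K)
    qed
    show "conj_code c g \<in> tp H b z" for c g
      unfolding conj_code_tp[where z = z, OF z] cst_index_def z_pair by (simp add: v_def f_inner inner_aut_def)
    show "\<exists>n. \<forall>k g. tail_code n k g \<in> tp H b z"
    proof (intro exI[of _ n] allI)
      fix k g
      have "v (code (Var (n + k))) = \<one>\<^bsub>K\<^esub>" using s(3) by (simp add: v_def)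
      then show "tail_code n k g \<in> tp H b z" unfolding tail_code_def using fixed by blast
    qed
    show "t \<in> A \<longleftrightarrow> (\<forall>g. fix_code t g \<in> tp H b z)" for t
      unfolding fixed s(1) by (simp add: tp_def v_def)
  qed
qed

end

section \<open>The step is first-order over the structure\<close>

lemmas definable_intros =
  definable_conj definable_imp definable_iff definable_exN definable_exS definable_allN definable_allS
  definable_InX definable_mem definable_term_var definable_term_const definable_term_pair
  definable_term_app2[where f = cut_code] definable_term_app[where f = odd_code]
  definable_term_app2[where f = even_code] definable_term_app2[where f = source_code]
  definable_term_app3[where f = target_code] definable_term_app3[where f = mul_index]
  definable_term_app2[where f = inv_index] definable_term_app2[where f = cst_index]
  definable_term_app2[where f = conj_code] definable_term_app2[where f = fix_code]
  definable_term_app3[where f = tail_code]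

lemma definable_seq_types: "definable G (\<lambda>X u v. seq_types X (v i))"
  unfolding seq_types_def by (intro definable_intros)

lemma definable_odd_part: "definable G (\<lambda>X u v. odd_part (v i) (v j))"
  unfolding odd_part_def by (intro definable_intros)

lemma definable_even_part: "definable G (\<lambda>X u v. even_part (u k) (v i) (v j))"
  unfolding even_part_def by (intro definable_intros)

lemma definable_acts: "definable G (\<lambda>X u v. acts X (v i) (u j))"
  unfolding acts_def
  by (intro definable_intros definable_seq_types definable_odd_part definable_even_part)

lemma definable_succ_formula: "definable G (\<lambda>X u v. succ_formula e X (v i))"
  unfolding succ_formula_def maps_def
  by (intro definable_intros definable_seq_types definable_acts)

section \<open>Closure ordinals are bounded\<close>

unbundle cardinal_syntax

text \<open>A cardinal well-order of the power set of \<open>'m\<close> has one proper initial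
  segment for each subset, and these have distinct order types. An injection of them into
  \<open>'m\<close> would contradict Cantor's theorem.\<close>

lemma ex_long_ordinal: "\<exists>\<delta> :: 'm set ordinal. \<nexists>g :: 'm set ordinal \<Rightarrow> 'm. inj_on g {..<\<delta>}"
proof -
  define r where "r = |UNIV :: 'm set set|"
  have W: "Well_order r" and F: "Field r = UNIV" unfolding r_def by (rule card_of_Well_order, rule Field_card_of)
  interpret wo_rel r using W by (simp add: wo_rel_def)
  let ?s = "\<lambda>a. Restr r (underS a)"
  let ?o = "\<lambda>a. abs_ordinal (?s a)"
  have less: "?s a <o r" for a using W F by (intro underS_Restr_ordLess) auto
  have refl: "?s a =o ?s a" "r =o r" for a using less[of a] by (simp_all add: ordLess_def ordIso_reflexive)
  have strict: "?o a < ?o b" if "(a, b) \<in> r" "a \<noteq> b" for a b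
  proof -
    have "underS a \<subseteq> underS b" using underS_incl_iff[of r a b] LIN F that by simp
    moreover have "a \<in> underS b" "a \<notin> underS a" using that by (auto simp: underS_def)
    ultimately have "underS a \<subset> underS b" by blast
    then have "?s a <o ?s b" using ofilter_subset_ordLess[OF W underS_ofilter underS_ofilter] by blast
    then show ?thesis using less_ordinal.abs_eq[OF refl(1) refl(1)] by blast
  qed
  have inj: "inj ?o"
  proof (rule injI, rule ccontr)
    fix a b assume eq: "?o a = ?o b" and ne: "a \<noteq> b"
    have "(a, b) \<in> r \<or> (b, a) \<in> r" using TOTALS F by blast
    then show False using strict[of a b] strict[of b a] eq ne by auto
  qed
  have below: "?o a < abs_ordinal r" for a using less_ordinal.abs_eq[OF refl] less by blast
  have "\<not> inj_on g {..<abs_ordinal r}" for g :: "'m set ordinal \<Rightarrow> 'm"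
  proof
    assume "inj_on g {..<abs_ordinal r}"
    then have "inj_on g (range ?o)" by (rule inj_on_subset) (use below in auto)
    then have "inj (g \<circ> ?o)" by (rule comp_inj_on[OF inj])
    then have "surj (inv_into UNIV (g \<circ> ?o))" by (rule inj_imp_surj_inv)
    then have "inv_into UNIV (g \<circ> ?o) ` UNIV = Pow UNIV" by simp
    then show False using Cantors_theorem by blast
  qed
  then show ?thesis by blast
qed

unbundle no cardinal_syntax

lemma stage_mono:
  fixes \<alpha> \<beta> :: "'o :: {wellorder, no_top}"
  shows "\<beta> \<le> \<alpha> \<Longrightarrow> stage M \<phi> p \<beta> \<subseteq> stage M \<phi> p \<alpha>"
proof (induction \<alpha> arbitrary: \<beta> rule: less_induct)
  case (less \<alpha>)
  show ?case
  proof (cases \<alpha> rule: ordinal_cases)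
    case zero
    then show ?thesis using less.prems ozero_le[of \<beta>] by simp
  next
    case (suc \<gamma>)
    show ?thesis
    proof (cases "\<beta> = \<alpha>")
      case False
      then have "\<beta> \<le> \<gamma>" using less.prems suc less_osuc_iff by (metis le_less)
      then have "stage M \<phi> p \<beta> \<subseteq> stage M \<phi> p \<gamma>" using less.IH[of \<gamma>] suc less_osuc by blast
      then show ?thesis unfolding suc stage_osuc by blast
    qed simp
  next
    case limit
    show ?thesis
    proof (cases "\<beta> = \<alpha>")
      case False
      then have "\<beta> < \<alpha>" using less.prems by simp
      then show ?thesis unfolding stage_limit[OF limit] by blast
    qed simp
  qed
qed

text \<open>If every stage below the ordinal of \<open>ex_long_ordinal\<close> grew, choosing a new
  element at each would be injective. The bound is uniform, which makes the least ordinals in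
  \<open>closure_ordinal\<close> and \<open>inductive_ordinal\<close> genuine.\<close>

lemma closure_ordinal_bounded:
  "\<exists>\<delta> :: 'm :: infinite set ordinal. \<forall>M :: ('s, 'm) struc. \<forall>\<phi> p.
    closure_ordinal M \<phi> p < \<delta> \<and>
    stage M \<phi> p (closure_ordinal M \<phi> p :: 'm set ordinal) = stage M \<phi> p (osuc (closure_ordinal M \<phi> p :: 'm set ordinal))"
proof -
  obtain \<delta> :: "'m set ordinal" where \<delta>: "\<And>g :: 'm set ordinal \<Rightarrow> 'm. \<not> inj_on g {..<\<delta>}"
    using ex_long_ordinal by blast
  have "closure_ordinal M \<phi> p < \<delta> \<and>
      stage M \<phi> p (closure_ordinal M \<phi> p :: 'm set ordinal) = stage M \<phi> p (osuc (closure_ordinal M \<phi> p :: 'm set ordinal))"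
    for M :: "('s, 'm) struc" and \<phi> p
  proof -
    have "\<exists>\<alpha><\<delta>. stage M \<phi> p \<alpha> = stage M \<phi> p (osuc \<alpha>)"
    proof (rule ccontr)
      assume no: "\<not> (\<exists>\<alpha><\<delta>. stage M \<phi> p \<alpha> = stage M \<phi> p (osuc \<alpha>))"
      have "\<exists>x. x \<in> stage M \<phi> p (osuc \<alpha>) \<and> x \<notin> stage M \<phi> p \<alpha>" if "\<alpha> < \<delta>" for \<alpha>
        using no that stage_mono[OF less_imp_le[OF less_osuc], of M \<phi> p \<alpha>] by blast
      then obtain g where g: "\<And>\<alpha>. \<alpha> < \<delta> \<Longrightarrow> g \<alpha> \<in> stage M \<phi> p (osuc \<alpha>) \<and> g \<alpha> \<notin> stage M \<phi> p \<alpha>"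
        by metis
      have "g \<alpha> \<noteq> g \<beta>" if "\<alpha> < \<beta>" "\<beta> < \<delta>" for \<alpha> \<beta>
      proof -
        have "osuc \<alpha> \<le> \<beta>" unfolding osuc_def using that(1) by (rule Least_le)
        moreover have "\<alpha> < \<delta>" using that by (rule less_trans)
        ultimately show ?thesis using g[of \<alpha>] g[of \<beta>] that(2) stage_mono[of "osuc \<alpha>" \<beta> M \<phi> p] by auto
      qed
      then have "inj_on g {..<\<delta>}" by (auto simp: inj_on_def) (metis neqE)
      then show False using \<delta> by blast
    qed
    then obtain \<alpha> where \<alpha>: "\<alpha> < \<delta>" "stage M \<phi> p \<alpha> = stage M \<phi> p (osuc \<alpha>)" by blast
    have "closure_ordinal M \<phi> p \<le> \<alpha>" unfolding closure_ordinal_def using \<alpha>(2) by (rule Least_le)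
    moreover have "stage M \<phi> p (closure_ordinal M \<phi> p :: 'm set ordinal) = stage M \<phi> p (osuc (closure_ordinal M \<phi> p :: 'm set ordinal))"
      unfolding closure_ordinal_def using \<alpha>(2) by (rule LeastI)
    ultimately show ?thesis using \<alpha>(1) by simp
  qed
  then show ?thesis by blast
qed

lemma closure_ordinal_less:
  fixes M :: "('s, 'm :: infinite) struc"
  shows "closure_ordinal M \<phi> p < inductive_ordinal M"
proof -
  have "\<exists>\<delta> :: 'm set ordinal. \<forall>\<phi> p. closure_ordinal M \<phi> p < \<delta>" using closure_ordinal_bounded by blast
  then have "\<forall>\<phi> p. closure_ordinal M \<phi> p < inductive_ordinal M"
    unfolding inductive_ordinal_def by (rule LeastI_ex)
  then show ?thesis by blast
qed

lemma closure_ordinal_closed: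
  fixes M :: "('s, 'm :: infinite) struc"
  shows "stage M \<phi> p (closure_ordinal M \<phi> p :: 'm set ordinal) = stage M \<phi> p (osuc (closure_ordinal M \<phi> p :: 'm set ordinal))"
  using closure_ordinal_bounded by blast

section \<open>The tower as an inductive definition\<close>

lemma finite_types_extends:
  assumes "extends H K" "group H" "group K" "\<And>c. b c \<in> carrier H"
  shows "finite_types H b \<subseteq> finite_types K b"
proof
  fix A assume "A \<in> finite_types H b"
  then obtain s where s: "A = tp H b s" "\<And>i. s i \<in> carrier H" "\<exists>n. \<forall>i\<ge>n. s i = \<one>\<^bsub>H\<^esub>"
    unfolding finite_types_def by blast
  have "\<one>\<^bsub>K\<^esub> = \<one>\<^bsub>H\<^esub>" by (rule extends_one[OF assms(1-3)])
  moreover from this have "tp H b s = tp K b s"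
    using ev_extends[where b = b and s = s, OF assms(1-4) s(2)] by (simp add: tp_def)
  ultimately show "A \<in> finite_types K b"
    unfolding finite_types_def using s extends_carrier[OF assms(1)] by auto
qed

text \<open>A countable group has countably many finite sequences, so all their types fit into one
  binary relation on numbers, which can be a parameter. The number \<open>i\<close> codes a list of
  letters.\<close>

definition base_rel :: "('a, 'b) monoid_scheme \<Rightarrow> (nat \<Rightarrow> 'a) \<Rightarrow> nat \<Rightarrow> nat \<Rightarrow> bool" where
  "base_rel H b i t \<longleftrightarrow>
    t \<in> tp H b (\<lambda>j. if j < length (from_nat i :: nat list) then b ((from_nat i :: nat list) ! j) else \<one>\<^bsub>H\<^esub>)"

lemma finite_types_base:
  assumes "group H" "range b = carrier H"
  shows "A \<in> finite_types H b \<longleftrightarrow> (\<exists>i. \<forall>t. t \<in> A \<longleftrightarrow> base_rel H b i t)"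
proof
  interpret group H by fact
  assume "A \<in> finite_types H b"
  then obtain s n where s: "A = tp H b s" "\<And>i. s i \<in> carrier H" "\<And>i. i \<ge> n \<Longrightarrow> s i = \<one>\<^bsub>H\<^esub>"
    unfolding finite_types_def by blast
  have "\<exists>c. b c = s i" for i using s(2)[of i] assms(2) by (metis imageE)
  then obtain c where c: "\<And>i. b (c i) = s i" by metis
  let ?l = "map c [0..<n]"
  have "(\<lambda>j. if j < length ?l then b (?l ! j) else \<one>\<^bsub>H\<^esub>) = s" using s(3) by (auto simp: c fun_eq_iff)
  then have "\<forall>t. t \<in> A \<longleftrightarrow> base_rel H b (to_nat ?l) t" by (simp only: base_rel_def from_nat_to_nat s(1)) simp
  then show "\<exists>i. \<forall>t. t \<in> A \<longleftrightarrow> base_rel H b i t" by blast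
next
  interpret group H by fact
  assume "\<exists>i. \<forall>t. t \<in> A \<longleftrightarrow> base_rel H b i t"
  then obtain i where i: "\<forall>t. t \<in> A \<longleftrightarrow> base_rel H b i t" by blast
  let ?l = "from_nat i :: nat list"
  have "A = tp H b (\<lambda>j. if j < length ?l then b (?l ! j) else \<one>\<^bsub>H\<^esub>)"
    using i unfolding base_rel_def by blast
  moreover have "b c \<in> carrier H" for c using assms(2) by blast
  ultimately show "A \<in> finite_types H b" unfolding finite_types_def
    by (intro CollectI exI[of _ "\<lambda>j. if j < length ?l then b (?l ! j) else \<one>\<^bsub>H\<^esub>"]) (auto intro!: exI[of _ "length ?l"])
qed

locale tower = G: group G for G :: "nat monoid" +
  fixes T :: "'o :: {wellorder, no_top} \<Rightarrow> 'u monoid" and h :: "nat \<Rightarrow> 'u"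
  assumes tower: "is_automorphism_tower G T"
    and h_iso: "h \<in> iso G (T ozero)"
begin

text \<open>Every number is a letter, so those outside the group are sent to the identity, which
  keeps all values in the bottom stage.\<close>

definition b :: "nat \<Rightarrow> 'u" where
  "b c = (if c \<in> carrier G then h c else \<one>\<^bsub>T ozero\<^esub>)"

lemma group_T: "group (T \<alpha>)"
  using tower by (simp add: is_automorphism_tower_def)

lemma T_osuc:
  "extends (T \<alpha>) (T (osuc \<alpha>))"
  "\<exists>f\<in>iso (T (osuc \<alpha>)) (AutoGroup (T \<alpha>)). \<forall>g\<in>carrier (T \<alpha>). f g = inner_aut (T \<alpha>) g"
  using tower unfolding is_automorphism_tower_def by blast+

lemma T_limit: "is_limit \<delta> \<Longrightarrow> carrier (T \<delta>) = (\<Union>\<beta>\<in>{..<\<delta>}. carrier (T \<beta>))"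
  "is_limit \<delta> \<Longrightarrow> \<beta> < \<delta> \<Longrightarrow> extends (T \<beta>) (T \<delta>)"
  using tower unfolding is_automorphism_tower_def by blast+

lemma T_extends: "\<beta> \<le> \<alpha> \<Longrightarrow> extends (T \<beta>) (T \<alpha>)"
proof (induction \<alpha> arbitrary: \<beta> rule: less_induct)
  case (less \<alpha>)
  show ?case
  proof (cases "\<beta> = \<alpha>")
    case False
    then have lt: "\<beta> < \<alpha>" using less.prems by simp
    show ?thesis
    proof (cases \<alpha> rule: ordinal_cases)
      case zero
      then show ?thesis using lt ozero_le[of \<beta>] by simp
    next
      case (suc \<gamma>)
      then have "extends (T \<beta>) (T \<gamma>)" using less.IH[of \<gamma>] lt less_osuc_iff less_osuc by blast
      then show ?thesis unfolding suc using T_osuc(1) extends_trans by blast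
    next
      case limit
      then show ?thesis using T_limit(2) lt by blast
    qed
  qed (simp add: extends_refl)
qed

lemma T_subset: "\<beta> \<le> \<alpha> \<Longrightarrow> x \<in> carrier (T \<beta>) \<Longrightarrow> x \<in> carrier (T \<alpha>)"
  by (rule extends_carrier[OF T_extends])

lemma one_T: "\<one>\<^bsub>T \<alpha>\<^esub> = \<one>\<^bsub>T ozero\<^esub>"
  by (rule extends_one[OF T_extends[OF ozero_le] group_T group_T])

lemma range_b: "range b = carrier (T ozero)"
proof -
  interpret T: group "T ozero" by (rule group_T)
  have "h ` carrier G = carrier (T ozero)" using h_iso by (simp add: iso_def bij_betw_def)
  then show ?thesis using T.one_closed by (force simp: b_def)
qed

lemma b_closed: "b c \<in> carrier (T \<alpha>)"
  by (rule T_subset[OF ozero_le]) (use range_b in blast)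

lemma b_one: "b \<one>\<^bsub>G\<^esub> = \<one>\<^bsub>T \<alpha>\<^esub>"
proof -
  have "h \<in> hom G (T ozero)" using h_iso by (simp add: iso_def)
  then show ?thesis unfolding one_T[of \<alpha>] b_def using hom_one G.group_axioms group_T by (metis G.one_closed)
qed

lemma tower_step:
  assumes "determined (T \<alpha>) b"
  shows "\<exists>f. tower_step (T \<alpha>) b (T (osuc \<alpha>)) f \<one>\<^bsub>G\<^esub>"
proof -
  obtain f where f: "f \<in> iso (T (osuc \<alpha>)) (AutoGroup (T \<alpha>))" "\<forall>g\<in>carrier (T \<alpha>). f g = inner_aut (T \<alpha>) g"
    using T_osuc(2) by blast
  have "tower_step (T \<alpha>) b (T (osuc \<alpha>)) f \<one>\<^bsub>G\<^esub>"
    using assms group_T T_osuc(1) f b_one by (simp add: tower_step_def tower_step_axioms_def)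
  then show ?thesis by blast
qed

text \<open>In the bottom stage every element is the value of a letter. At a limit any two elements
  lie in a common earlier stage, where terms have the same values.\<close>

lemma determined_T: "determined (T \<alpha>) b"
proof (induction \<alpha> rule: less_induct)
  case (less \<alpha>)
  show ?case
  proof (cases \<alpha> rule: ordinal_cases)
    case zero
    interpret group "T ozero" by (rule group_T)
    show ?thesis unfolding zero
    proof
      fix x y assume x: "x \<in> carrier (T ozero)" and y: "y \<in> carrier (T ozero)"
        and st: "same_type (T ozero) b (\<lambda>_. x) b (\<lambda>_. y)"
      obtain c where c: "x = b c" using x range_b by blast
      let ?t = "Mul (Var 0) (Inv (Cst c))"
      have "ev (T ozero) b (\<lambda>_. x) ?t = \<one>\<^bsub>T ozero\<^esub>" using x by (simp add: c)
      then have "ev (T ozero) b (\<lambda>_. y) ?t = \<one>\<^bsub>T ozero\<^esub>" using st unfolding same_type_def by blast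
      then show "x = y" using mult_inv_eq_one[OF y x] by (simp add: c)
    qed (rule b_closed)
  next
    case (suc \<gamma>)
    then have "determined (T \<gamma>) b" using less.IH less_osuc by blast
    then obtain f where "tower_step (T \<gamma>) b (T (osuc \<gamma>)) f \<one>\<^bsub>G\<^esub>" using tower_step by blast
    then show ?thesis unfolding suc by (rule tower_step.determined_K)
  next
    case limit
    interpret group "T \<alpha>" by (rule group_T)
    show ?thesis
    proof
      fix x y assume "x \<in> carrier (T \<alpha>)" "y \<in> carrier (T \<alpha>)"
        and st: "same_type (T \<alpha>) b (\<lambda>_. x) b (\<lambda>_. y)"
      then obtain \<beta> \<gamma> where "\<beta> < \<alpha>" "\<gamma> < \<alpha>" "x \<in> carrier (T \<beta>)" "y \<in> carrier (T \<gamma>)"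
        unfolding T_limit(1)[OF limit] by blast
      then obtain \<epsilon> where e: "\<epsilon> < \<alpha>" "x \<in> carrier (T \<epsilon>)" "y \<in> carrier (T \<epsilon>)"
        using T_subset[of \<beta> "max \<beta> \<gamma>" x] T_subset[of \<gamma> "max \<beta> \<gamma>" y] by (metis max.cobounded1 max.cobounded2 max_def)
      have "ev (T \<alpha>) b (\<lambda>_. x) t = ev (T \<epsilon>) b (\<lambda>_. x) t" if "x \<in> carrier (T \<epsilon>)" for x t
        by (rule ev_extends[OF T_limit(2)[OF limit e(1)] group_T group_T b_closed that])
      then have "same_type (T \<epsilon>) b (\<lambda>_. x) b (\<lambda>_. y)"
        using st e by (simp add: same_type_def one_T[of \<alpha>] one_T[of \<epsilon>])
      then show "x = y" using determined.type_eq[OF less.IH[OF e(1)] e(2,3)] by blast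
    qed (rule b_closed)
  qed
qed

section \<open>The stages of the induction against those of the tower\<close>

definition types :: "'o \<Rightarrow> (nat + nat set) set" where
  "types \<alpha> = Inr ` finite_types (T \<alpha>) b"

lemma types_mono: "\<beta> \<le> \<alpha> \<Longrightarrow> types \<beta> \<subseteq> types \<alpha>"
  unfolding types_def by (intro image_mono finite_types_extends T_extends group_T b_closed)

text \<open>Finitely many entries lie in one earlier stage, and the others are the identity. For
  arbitrary infinite sequences this could fail at limits of countable cofinality.\<close>

lemma types_limit: assumes "is_limit \<delta>" shows "types \<delta> \<subseteq> (\<Union>\<beta>\<in>{..<\<delta>}. types \<beta>)"
proof
  fix X assume "X \<in> types \<delta>"
  then obtain s n where s: "X = Inr (tp (T \<delta>) b s)" "\<And>i. s i \<in> carrier (T \<delta>)"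
    "\<And>i. i \<ge> n \<Longrightarrow> s i = \<one>\<^bsub>T \<delta>\<^esub>"
    unfolding types_def finite_types_def by blast
  have "\<exists>\<beta><\<delta>. \<forall>i<m. s i \<in> carrier (T \<beta>)" for m
  proof (induction m)
    case 0
    then show ?case using assms by (auto simp: is_limit_def)
  next
    case (Suc m)
    then obtain \<beta> where \<beta>: "\<beta> < \<delta>" "\<forall>i<m. s i \<in> carrier (T \<beta>)" by blast
    obtain \<gamma> where \<gamma>: "\<gamma> < \<delta>" "s m \<in> carrier (T \<gamma>)" using s(2)[of m] unfolding T_limit(1)[OF assms] by blast
    have "s i \<in> carrier (T (max \<beta> \<gamma>))" if "i < Suc m" for i
      using that \<beta>(2) \<gamma>(2) T_subset[of \<beta> "max \<beta> \<gamma>"] T_subset[of \<gamma> "max \<beta> \<gamma>"] by (auto simp: less_Suc_eq)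
    then show ?case using \<beta>(1) \<gamma>(1) by (intro exI[of _ "max \<beta> \<gamma>"]) simp
  qed
  then obtain \<beta> where \<beta>: "\<beta> < \<delta>" "\<forall>i<n. s i \<in> carrier (T \<beta>)" by blast
  interpret group "T \<beta>" by (rule group_T)
  have one: "\<one>\<^bsub>T \<delta>\<^esub> = \<one>\<^bsub>T \<beta>\<^esub>" using one_T[of \<beta>] one_T[of \<delta>] by simp
  have sb: "s i \<in> carrier (T \<beta>)" for i
    using \<beta>(2) s(3)[of i] one by (cases "i < n") auto
  have "ev (T \<delta>) b s t = ev (T \<beta>) b s t" for t
    by (rule ev_extends[OF T_limit(2)[OF assms \<beta>(1)] group_T group_T b_closed sb])
  then have "tp (T \<delta>) b s = tp (T \<beta>) b s" by (simp add: tp_def one)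
  then have "X \<in> types \<beta>" unfolding types_def finite_types_def s(1) using sb s(3) one by auto
  then show "X \<in> (\<Union>\<beta>\<in>{..<\<delta>}. types \<beta>)" using \<beta>(1) by blast
qed

lemma carrier_eq_of_types_eq:
  assumes "types \<beta> = types (osuc \<beta>)" shows "carrier (T (osuc \<beta>)) = carrier (T \<beta>)"
proof -
  obtain f where "tower_step (T \<beta>) b (T (osuc \<beta>)) f \<one>\<^bsub>G\<^esub>" using tower_step[OF determined_T] by blast
  moreover have "finite_types (T (osuc \<beta>)) b = finite_types (T \<beta>) b"
    using assms unfolding types_def by (simp add: inj_image_eq_iff)
  ultimately show ?thesis by (rule tower_step.finite_types_eq_imp)
qed

text \<open>The first disjunct starts the induction: over the empty set \<open>succ_formula\<close>
  holds of nothing. Later it yields only types already present.\<close>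

definition tower_formula :: "(nat + nat set) set \<Rightarrow> nat set \<Rightarrow> bool" where
  "tower_formula X A \<longleftrightarrow> (\<exists>i. \<forall>t. t \<in> A \<longleftrightarrow> base_rel (T ozero) b i t) \<or> succ_formula \<one>\<^bsub>G\<^esub> X A"

lemma definable_tower_formula: "definable G (\<lambda>X u v. tower_formula X (v 0))"
  unfolding tower_formula_def
  by (intro definable_disj definable_succ_formula definable_intros definable_rel2[where R = "base_rel (T ozero) b"])

lemma tower_formula_empty: "Inr ` {A. tower_formula {} A} = types ozero"
proof -
  have "\<not> succ_formula e {} A" for e A by (simp add: succ_formula_def seq_types_def)
  then show ?thesis
    unfolding tower_formula_def types_def finite_types_base[OF group_T range_b, symmetric] by simp
qed

lemma tower_formula_types: "Inr ` {A. tower_formula (types \<alpha>) A} = types (osuc \<alpha>)"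
proof -
  obtain f where "tower_step (T \<alpha>) b (T (osuc \<alpha>)) f \<one>\<^bsub>G\<^esub>" using tower_step[OF determined_T] by blast
  then interpret tower_step "T \<alpha>" b "T (osuc \<alpha>)" f "\<one>\<^bsub>G\<^esub>" .
  have "succ_formula \<one>\<^bsub>G\<^esub> (types \<alpha>) A \<longleftrightarrow> A \<in> finite_types (T (osuc \<alpha>)) b" for A
    unfolding types_def using succ_formula_sound succ_formula_complete by blast
  then have "Inr ` {A. tower_formula (types \<alpha>) A} = types ozero \<union> types (osuc \<alpha>)"
    unfolding tower_formula_def finite_types_base[OF group_T range_b, symmetric] types_def by auto
  then show ?thesis using types_mono[OF ozero_le, of "osuc \<alpha>"] by blast
qed

text \<open>At finite \<open>\<alpha>\<close> the stage lags behind the tower by one step, because stage \<open>0\<close> is empty.\<close>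

lemma stage_types:
  assumes \<phi>: "\<And>X. formula_set (arith_struc G) \<phi> p X = Inr ` {A. tower_formula X A}"
  shows "\<alpha> = ozero \<and> stage (arith_struc G) \<phi> p \<alpha> = {} \<or>
    (\<exists>\<beta>\<le>\<alpha>. \<alpha> \<le> osuc \<beta> \<and> stage (arith_struc G) \<phi> p \<alpha> = types \<beta>)"
proof (induction \<alpha> rule: less_induct)
  case (less \<alpha>)
  show ?case
  proof (cases \<alpha> rule: ordinal_cases)
    case zero
    then show ?thesis by (simp add: stage_ozero)
  next
    case (suc \<gamma>)
    have st: "stage (arith_struc G) \<phi> p \<alpha> =
        stage (arith_struc G) \<phi> p \<gamma> \<union> Inr ` {A. tower_formula (stage (arith_struc G) \<phi> p \<gamma>) A}"
      unfolding suc stage_osuc \<phi>[symmetric] formula_set_def ..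
    consider "\<gamma> = ozero" "stage (arith_struc G) \<phi> p \<gamma> = {}"
      | \<beta> where "\<beta> \<le> \<gamma>" "\<gamma> \<le> osuc \<beta>" "stage (arith_struc G) \<phi> p \<gamma> = types \<beta>"
      using less.IH[of \<gamma>] suc less_osuc by blast
    then show ?thesis
    proof cases
      case 1
      then have "stage (arith_struc G) \<phi> p \<alpha> = types ozero" unfolding st by (simp add: tower_formula_empty)
      then show ?thesis using suc 1 ozero_le by blast
    next
      case (2 \<beta>)
      have "stage (arith_struc G) \<phi> p \<alpha> = types (osuc \<beta>)"
        unfolding st 2(3) tower_formula_types using types_mono[OF less_imp_le[OF less_osuc], of \<beta>] by blast
      moreover have "osuc \<beta> \<le> \<alpha>" "\<alpha> \<le> osuc (osuc \<beta>)"
        using 2(1,2) suc by (metis leD leI less_osuc_iff order.trans)+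
      ultimately show ?thesis by blast
    qed
  next
    case limit
    have "stage (arith_struc G) \<phi> p \<alpha> = types \<alpha>"
    proof (intro equalityI subsetI)
      fix x assume "x \<in> stage (arith_struc G) \<phi> p \<alpha>"
      then obtain \<gamma> where "\<gamma> < \<alpha>" "x \<in> stage (arith_struc G) \<phi> p \<gamma>" by (auto simp: stage_limit[OF limit])
      then obtain \<beta> where "\<beta> \<le> \<gamma>" "x \<in> types \<beta>" using less.IH[of \<gamma>] by blast
      moreover have "\<beta> \<le> \<alpha>" using \<open>\<beta> \<le> \<gamma>\<close> \<open>\<gamma> < \<alpha>\<close> by simp
      ultimately show "x \<in> types \<alpha>" using types_mono by blast
    next
      fix x assume "x \<in> types \<alpha>"
      then obtain \<gamma> where \<gamma>: "\<gamma> < \<alpha>" "x \<in> types \<gamma>" using types_limit[OF limit] by blast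
      \<comment> \<open>One extra step makes up for the lag: stage \<open>osuc \<gamma>\<close> is
        still below the limit, and its tower index is at least \<open>\<gamma>\<close>.\<close>
      have "osuc \<gamma> < \<alpha>" using \<gamma>(1) limit not_limit_osuc unfolding osuc_def
        by (metis Least_le le_less osuc_def)
      moreover obtain \<beta> where "osuc \<gamma> \<le> osuc \<beta>" "stage (arith_struc G) \<phi> p (osuc \<gamma>) = types \<beta>"
        using less.IH[OF \<open>osuc \<gamma> < \<alpha>\<close>] osuc_neq_ozero by blast
      moreover have "\<gamma> \<le> \<beta>" using \<open>osuc \<gamma> \<le> osuc \<beta>\<close> by (metis leD leI less_osuc_iff)
      ultimately show "x \<in> stage (arith_struc G) \<phi> p \<alpha>"
        using \<gamma>(2) types_mono[of \<gamma> \<beta>] by (auto simp: stage_limit[OF limit])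
    qed
    then show ?thesis using less_osuc[of \<alpha>] by (intro disjI2 exI[of _ \<alpha>]) simp
  qed
qed

text \<open>A closed stage is not empty, since the formula yields \<open>types ozero\<close> over
  the empty set; so it is some \<open>types \<beta>\<close>. The lag has the right direction:
  \<open>\<beta> \<le> \<alpha>\<close> makes \<open>\<alpha>\<close> bound the height.\<close>

lemma stationary_of_stage_eq:
  assumes \<phi>: "\<And>X. formula_set (arith_struc G) \<phi> p X = Inr ` {A. tower_formula X A}"
    and eq: "stage (arith_struc G) \<phi> p \<alpha> = stage (arith_struc G) \<phi> p (osuc \<alpha>)"
  shows "\<exists>\<beta>\<le>\<alpha>. carrier (T (osuc \<beta>)) = carrier (T \<beta>)"
proof -
  have st: "Inr ` {A. tower_formula (stage (arith_struc G) \<phi> p \<alpha>) A} \<subseteq> stage (arith_struc G) \<phi> p \<alpha>"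
    using eq unfolding stage_osuc \<phi>[symmetric] formula_set_def by blast
  have "types ozero \<noteq> {}"
  proof -
    interpret group "T ozero" by (rule group_T)
    have "tp (T ozero) b (\<lambda>_. \<one>\<^bsub>T ozero\<^esub>) \<in> finite_types (T ozero) b"
      unfolding finite_types_def by (intro CollectI exI[of _ "\<lambda>_. \<one>\<^bsub>T ozero\<^esub>"]) simp
    then show ?thesis by (auto simp: types_def)
  qed
  then have "stage (arith_struc G) \<phi> p \<alpha> \<noteq> {}" using st tower_formula_empty by force
  then obtain \<beta> where \<beta>: "\<beta> \<le> \<alpha>" "stage (arith_struc G) \<phi> p \<alpha> = types \<beta>"
    using stage_types[OF \<phi>, of \<alpha>] by blast
  have "types (osuc \<beta>) \<subseteq> types \<beta>" using st unfolding \<beta>(2) tower_formula_types .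
  then have "types \<beta> = types (osuc \<beta>)" using types_mono[OF less_imp_le[OF less_osuc], of \<beta>] by blast
  then show ?thesis using \<beta>(1) carrier_eq_of_types_eq by blast
qed

end

theorem theorem4p2:
  fixes G :: "nat monoid"
  assumes "group G" and "centerless G"
  shows "tower_height G < inductive_ordinal (arith_struc G)"
proof -
  \<comment> \<open>The tower is indexed by the ordinals in which the closure ordinals of the
    structure are measured, so the two can be compared directly.\<close>
  let ?T = "automorphism_tower G :: (nat + nat set) set ordinal \<Rightarrow> nat tower_elt monoid"
  have tower: "is_automorphism_tower G ?T" by (rule is_automorphism_tower[OF assms])
  then obtain h where "h \<in> iso G (?T ozero)" by (auto simp: is_automorphism_tower_def is_iso_def)
  then interpret tower G ?T h using assms tower by (simp add: tower_def tower_axioms_def)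
  obtain \<phi> p where \<phi>: "\<And>X. formula_set (arith_struc G) \<phi> p X = Inr ` {A. tower_formula X A}"
    using definable_formula_set[OF definable_tower_formula] by blast
  let ?\<alpha> = "closure_ordinal (arith_struc G) \<phi> p :: (nat + nat set) set ordinal"
  obtain \<beta> where \<beta>: "\<beta> \<le> ?\<alpha>" "carrier (?T (osuc \<beta>)) = carrier (?T \<beta>)"
    using stationary_of_stage_eq[OF \<phi> closure_ordinal_closed] by blast
  have "tower_height G \<le> \<beta>" unfolding tower_height_def using \<beta>(2) by (rule Least_le)
  also have "\<dots> < inductive_ordinal (arith_struc G)"
    using \<beta>(1) closure_ordinal_less by (rule order.strict_trans1)
  finally show ?thesis .
qed

end
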